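(* Let $k\ge 2$ be an integer and let $A_0(z),A_1(z),\dots,A_{k-1}(z)$ be entire functions. Put $L(f):=f^{(k)}+A_{k-1}(z)f^{(k-1)}+\cdots+A_1(z)f'+A_0(z)f$. Then the nontrivial solutions $f$ ($f\not\equiv 0$) of $L(f)=0$ satisfy $$\sup\{\sigma_{(\alpha(\log),\beta,\gamma)}[f] : L(f)=0\}=\sup\{\sigma_{(\alpha,\beta,\gamma)}[A_j] : j=0,\dots,k-1\}.$$
   Context: Notation: $\log^{[0]}x=x$, $\log^{[p]}x=\log(\log^{[p-1]}x)$. Let $L$ be the class of continuous non-negative functions $\alpha$ on $(-\infty,+\infty)$ such that, for some $x_0$, $\alpha(x)=\alpha(x_0)\ge 0$ for $x\le x_0$ and $\alpha(x)$ increases to $+\infty$ as $x_0\le x\to+\infty$. Write $\alpha\in L_1$ if $\alpha\in L$ and $\alpha(a+b)\le\alpha(a)+\alpha(b)+c$ for all $a,b\ge R_0$ and some fixed $c\in(0,+\infty)$; $\alpha\in L_2$ if $\alpha\in L$ and $\alpha(x+O(1))=(1+o(1))\alpha(x)$ as $x\to+\infty$; $\alpha\in L_3$ if $\alpha\in L$ and $\alpha(a+b)\le\alpha(a)+\alpha(b)$ for all $a,b\ge R_0$. Standing assumptions on $\alpha,\beta,\gamma$: (i) $\alpha\in L_1$, $\beta\in L_2$, $\gamma\in L_3$; (ii) as $x\to+\infty$: $\alpha(\log^{[p]}x)=o(\beta(\log\gamma(x)))$ for $p\ge 2$, $\alpha(\log x)=o(\alpha(x))$, and $\alpha^{-1}(\kappa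 x)=o(\alpha^{-1}(x))$ for $0<\kappa<1$. For a meromorphic function $f$ on $\mathbb{C}$ with Nevanlinna characteristic $T(r,f)$, the $(\alpha,\beta,\gamma)$-order and the $(\alpha(\log),\beta,\gamma)$-order are $$\sigma_{(\alpha,\beta,\gamma)}[f]=\limsup_{r\to+\infty}\frac{\alpha(\log T(r,f))}{\beta(\log\gamma(r))},\qquad \sigma_{(\alpha(\log),\beta,\gamma)}[f]=\limsup_{r\to+\infty}\frac{\alpha(\log^{[2]}T(r,f))}{\beta(\log\gamma(r))}.$$ The supremum on the left-hand side of the claim is over nontrivial solutions. *)

theory Defs
  imports "HOL-Complex_Analysis.Complex_Analysis" "HOL-Library.Landau_Symbols"
begin

definition class_L :: "(real \<Rightarrow> real) set" where
  "class_L = {\<alpha>. continuous_on UNIV \<alpha> \<and> (\<forall>x. 0 \<le> \<alpha> x) \<and>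
     (\<exists>x0. (\<forall>x\<le>x0. \<alpha> x = \<alpha> x0) \<and> mono_on {x0..} \<alpha>) \<and>
     filterlim \<alpha> at_top at_top}"

definition class_L1 :: "(real \<Rightarrow> real) set" where
  "class_L1 = {\<alpha> \<in> class_L.
     \<exists>c>0. \<exists>R0. \<forall>a\<ge>R0. \<forall>b\<ge>R0. \<alpha> (a + b) \<le> \<alpha> a + \<alpha> b + c}"

definition class_L2 :: "(real \<Rightarrow> real) set" where
  "class_L2 = {\<alpha> \<in> class_L.
     \<forall>h \<in> O[at_top](\<lambda>_. 1). asymp_equiv (\<lambda>x. \<alpha> (x + h x)) at_top \<alpha>}"

definition class_L3 :: "(real \<Rightarrow> real) set" where
  "class_L3 = {\<alpha> \<in> class_L. \<exists>R0. \<forall>a\<ge>R0. \<forall>b\<ge>R0. \<alpha> (a + b) \<le> \<alpha> a + \<alpha> b}"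

definition log_plus :: "real \<Rightarrow> real" where
  "log_plus x = max 0 (ln x)"

definition proximity_function :: "real \<Rightarrow> (complex \<Rightarrow> complex) \<Rightarrow> real" where
  "proximity_function r f =
     1 / (2 * pi) * integral {0..2 * pi} (\<lambda>\<theta>. log_plus (norm (f (of_real r * cis \<theta>))))"

(* number of poles in the closed disc of radius r, counted with multiplicity *)
definition pole_count :: "real \<Rightarrow> (complex \<Rightarrow> complex) \<Rightarrow> nat" where
  "pole_count r f = (\<Sum>z | norm z \<le> r \<and> is_pole f z. nat (- zorder f z))"

definition counting_function :: "real \<Rightarrow> (complex \<Rightarrow> complex) \<Rightarrow> real" where
  "counting_function r f =
     integral {0..r} (\<lambda>t. (real (pole_count t f) - real (pole_count 0 f)) / t)
     + real (pole_count 0 f) * ln r"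

definition nevanlinna_T :: "real \<Rightarrow> (complex \<Rightarrow> complex) \<Rightarrow> real" where
  "nevanlinna_T r f = proximity_function r f + counting_function r f"

(* The (\<alpha>(log),\<beta>,\<gamma>)-order is the instance with \<lambda>x. \<alpha> (ln x) in place of \<alpha>.
   The totalised values of ln on nonpositive arguments have no influence: for entire f, either f
   is nonconstant and nevanlinna_T r f tends to infinity, or f is constant and the numerator is
   constant while the denominator tends to infinity for \<beta>, \<gamma> in class_L. *)
definition growth_order ::
  "(real \<Rightarrow> real) \<Rightarrow> (real \<Rightarrow> real) \<Rightarrow> (real \<Rightarrow> real) \<Rightarrow> (complex \<Rightarrow> complex) \<Rightarrow> ereal" where
  "growth_order \<alpha> \<beta> \<gamma> f =
     Limsup at_top (\<lambda>r. ereal (\<alpha> (ln (nevanlinna_T r f)) / \<beta> (ln (\<gamma> r))))"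

definition lin_diff_op ::
  "nat \<Rightarrow> (nat \<Rightarrow> complex \<Rightarrow> complex) \<Rightarrow> (complex \<Rightarrow> complex) \<Rightarrow> complex \<Rightarrow> complex" where
  "lin_diff_op k A f z = (deriv ^^ k) f z + (\<Sum>j<k. A j z * (deriv ^^ j) f z)"

(* Solutions are taken entire: with entire coefficients every solution is. *)
definition nontrivial_solutions ::
  "nat \<Rightarrow> (nat \<Rightarrow> complex \<Rightarrow> complex) \<Rightarrow> (complex \<Rightarrow> complex) set" where
  "nontrivial_solutions k A =
     {f. f holomorphic_on UNIV \<and> f \<noteq> (\<lambda>_. 0) \<and> (\<forall>z. lin_diff_op k A f z = 0)}"

(* The growth conditions linking \<alpha>, \<beta>, \<gamma>. In the last one, if \<alpha> is strictly increasing on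
   {x0..} and constant on {..x0}, then inv \<alpha> y is the unique preimage of y for y > \<alpha> x0. If
   \<alpha> has plateaus, the condition (over all \<kappa>) does not depend on which preimages
   inv chooses. *)
definition growth_conditions ::
  "(real \<Rightarrow> real) \<Rightarrow> (real \<Rightarrow> real) \<Rightarrow> (real \<Rightarrow> real) \<Rightarrow> bool" where
  "growth_conditions \<alpha> \<beta> \<gamma> \<longleftrightarrow>
     (\<forall>p\<ge>2. (\<lambda>x. \<alpha> ((ln ^^ p) x)) \<in> o[at_top](\<lambda>x. \<beta> (ln (\<gamma> x)))) \<and>
     (\<lambda>x. \<alpha> (ln x)) \<in> o[at_top](\<alpha>) \<and>
     (\<forall>\<kappa>. 0 < \<kappa> \<and> \<kappa> < 1 \<longrightarrow> (\<lambda>x. inv \<alpha> (\<kappa> * x)) \<in> o[at_top](inv \<alpha>))"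

end

theory Submission
  imports Defs
begin

text \<open>
  The radius in \<open>\<beta> (ln (\<gamma> r))\<close> may be multiplied by a constant without changing the orders, because
  \<open>\<gamma>\<close> is subadditive and \<open>\<beta>\<close> is stable under bounded shifts. Hence pointwise bounds on discs of
  comparable radii suffice, and no exceptional sets occur. A Gronwall estimate bounds
  \<open>ln T(r, f)\<close> by \<open>O(ln r + max T(2 r, A j))\<close>, which gives one inequality.

  For the other one, take the solutions \<open>f i\<close> with normalised initial values at 0 and eliminate them one
  after another by reduction of order, written with entire functions throughout. At a point
  where the successive leading functions \<open>h\<close> do not vanish, the coefficients are bounded polynomially
  by the quotients of derivatives of \<open>h\<close> by \<open>h\<close>. On a circle that stays away from the zeros of all these \<open>h\<close>,
  the quotients are bounded by a power of \<open>L\<close> if \<open>|f i| \<le> exp L\<close> on a larger disc; by the maximum principle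
  so are the coefficients, hence \<open>T(r, A j) = O(max (ln r) (ln T(20 r, f i)))\<close>.
\<close>

section \<open>Reduction of order\<close>

text \<open>Crude constants are affordable: a constant factor becomes an additive constant under a
  logarithm, and \<open>class_L1\<close> absorbs additive constants. A power of \<open>L\<close> is
  harmless because the coefficients enter through \<open>ln L\<close>, where it is again a constant
  factor. Terms in \<open>ln r\<close> cost \<open>\<alpha> (ln (ln r))\<close>, which is negligible
  by the case p = 2 of the growth conditions. The obstacle is that quotients of solutions are
  meromorphic and that estimates of logarithmic derivatives break down near zeros. Multiplying the
  derivative of a quotient by the square of its denominator keeps everything entire, at the price of
  a factor 4 in the exponent per step. Each leading function then has only O(L) zeros to be avoided,
  so some circle with radius between \<open>r\<close> and \<open>3 / 2 * r\<close> keeps a distance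
  of order 1/L from all of them. The factor 20 is 2 * 10: radius \<open>9 * r\<close> serves the
  zeros and logarithmic derivatives, one more \<open>r\<close> is room for Cauchy estimates in fewer
  than \<open>k \<le> r\<close> reduction steps, and the doubling is the passage from the
  characteristic to pointwise bounds.\<close>

text \<open>Leibniz' formula for the \<open>n\<close>-th derivative of \<open>x' y - x y'\<close>,
  as a bilinear form in sequences of derivatives at one point. It also makes sense for arbitrary
  sequences, such as unit vectors.\<close>

definition wronskian_jet :: "(nat \<Rightarrow> complex) \<Rightarrow> (nat \<Rightarrow> complex) \<Rightarrow> nat \<Rightarrow> complex" where
  "wronskian_jet y x n =
     (\<Sum>i=0..n. of_nat (n choose i) * (x (Suc i) * y (n - i) - x i * y (Suc (n - i))))"

text \<open>This is \<open>(g 0)\<^sup>2\<close> times the derivative of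
  \<open>g (Suc i) / g 0\<close>, the function produced by d'Alembert's reduction with the
  denominator cleared.\<close>

definition order_red :: "(nat \<Rightarrow> complex \<Rightarrow> complex) \<Rightarrow> nat \<Rightarrow> complex \<Rightarrow> complex" where
  "order_red g i z = deriv (g (Suc i)) z * g 0 z - g (Suc i) z * deriv (g 0) z"

lemma higher_deriv_order_red:
  assumes "\<And>i. g i holomorphic_on UNIV"
  shows "(deriv ^^ n) (order_red g i) z =
    wronskian_jet (\<lambda>m. (deriv ^^ m) (g 0) z) (\<lambda>m. (deriv ^^ m) (g (Suc i)) z) n"
proof -
  have Suc: "(deriv ^^ m) (deriv f) = (deriv ^^ Suc m) f" for m and f :: "complex \<Rightarrow> complex"
    by (simp only: funpow_Suc_right o_def)
  have h: "deriv (g j) holomorphic_on UNIV" for j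
    by (simp add: assms holomorphic_deriv)
  have "(deriv ^^ n) (order_red g i) z =
      (deriv ^^ n) (\<lambda>z. deriv (g (Suc i)) z * g 0 z) z -
      (deriv ^^ n) (\<lambda>z. g (Suc i) z * deriv (g 0) z) z"
    unfolding order_red_def
    by (rule higher_deriv_diff[of _ UNIV]) (auto intro!: holomorphic_intros assms h)
  also have "\<dots> = wronskian_jet (\<lambda>m. (deriv ^^ m) (g 0) z) (\<lambda>m. (deriv ^^ m) (g (Suc i)) z) n"
    using higher_deriv_mult[of "deriv (g (Suc i))" UNIV "g 0" z n]
      higher_deriv_mult[of "g (Suc i)" UNIV "deriv (g 0)" z n] h assms
    by (simp add: Suc wronskian_jet_def sum_subtractf[symmetric] algebra_simps del: funpow.simps)
  finally show ?thesis .
qed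

lemma holomorphic_order_red:
  assumes "\<And>i. g i holomorphic_on UNIV"
  shows "order_red g i holomorphic_on UNIV"
  unfolding order_red_def[abs_def] by (intro holomorphic_intros assms holomorphic_deriv) auto

lemma holomorphic_iterated_order_red:
  assumes "\<And>i. g i holomorphic_on UNIV"
  shows "(order_red ^^ n) g i holomorphic_on UNIV"
  by (induction n arbitrary: i) (auto intro!: holomorphic_order_red assms)

text \<open>If \<open>y\<close> looks like the jet of the constant 1, the Wronskian is plain
  differentiation of \<open>x\<close>. At the origin one reduction step therefore shifts both
  indices of the unit initial values by one.\<close>

lemma wronskian_jet_unit:
  assumes "\<And>m. m \<le> Suc n \<Longrightarrow> y m = (if m = 0 then 1 else 0)"
  shows "wronskian_jet y x n = x (Suc n)"
proof -
  have "wronskian_jet y x n = (\<Sum>i=0..n. if i = n then x (Suc n) else 0)"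
    unfolding wronskian_jet_def by (rule sum.cong) (auto simp: assms)
  then show ?thesis by simp
qed

text \<open>The normalised initial values replace an argument about linear independence: they make every
  function by which the reduction of order divides equal to 1 at the origin.\<close>

lemma order_red_head_at_0:
  assumes "\<And>i. g i holomorphic_on UNIV"
    and "\<And>i m. i < k \<Longrightarrow> m < k \<Longrightarrow> (deriv ^^ m) (g i) 0 = (if m = i then 1 else 0)"
    and "n < k"
  shows "(order_red ^^ n) g 0 0 = 1"
  using assms
proof (induction n arbitrary: g k)
  case 0
  then show ?case using 0(2)[of 0 0] by simp
next
  case (Suc n)
  have "(order_red ^^ n) (order_red g) 0 0 = 1"
  proof (rule Suc.IH[of _ "k - 1"])
    show "order_red g i holomorphic_on UNIV" for i
      by (rule holomorphic_order_red) (rule Suc.prems)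
    show "(deriv ^^ m) (order_red g i) 0 = (if m = i then 1 else 0)"
      if "i < k - 1" "m < k - 1" for i m
    proof -
      have "(deriv ^^ m) (order_red g i) 0 = (deriv ^^ Suc m) (g (Suc i)) 0"
        unfolding higher_deriv_order_red[OF Suc.prems(1)]
        by (rule wronskian_jet_unit) (use that Suc.prems(2)[of 0] in auto)
      then show ?thesis using Suc.prems(2)[of "Suc i" "Suc m"] that by auto
    qed
    show "n < k - 1" using Suc.prems by auto
  qed
  then show ?case by (simp add: funpow_swap1)
qed

text \<open>The pointwise form of d'Alembert's reduction of order.\<close>

lemma linear_form_factor:
  assumes "(\<Sum>m\<le>k. a m * y m) = 0" and "y 0 \<noteq> 0"
  obtains b where "\<And>x. (\<Sum>m\<le>k. a m * x m) = (\<Sum>n<k. b n * wronskian_jet y x n)"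
    and "k > 0 \<Longrightarrow> b (k - 1) * y 0 = a k"
proof -
  have "\<exists>b. (\<forall>x. (\<Sum>m\<le>k. a m * x m) = (\<Sum>n<k. b n * wronskian_jet y x n)) \<and>
     (k > 0 \<longrightarrow> b (k - 1) * y 0 = a k)"
    using assms(1)
  proof (induction k arbitrary: a)
    case 0
    then show ?case using assms(2) by auto
  next
    case (Suc k)
    \<comment> \<open>\<open>y 0\<close> is the leading coefficient of
      \<open>wronskian_jet y _ k\<close>, and \<open>w i\<close> is its coefficient at
      \<open>x i\<close>. Subtracting \<open>c\<close> times this form lowers the order, as in
      division with remainder.\<close>
    define c where "c = a (Suc k) / y 0"
    define w where "w i = (if i = 0 then 0 else of_nat (k choose (i - 1)) * y (k - (i - 1)))
        - of_nat (k choose i) * y (Suc (k - i))" for i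
    define a' where "a' i = a i - c * w i" for i
    have W: "wronskian_jet y x k = y 0 * x (Suc k) + (\<Sum>i\<le>k. w i * x i)" for x
    proof -
      have *: "(\<Sum>i=0..k. of_nat (k choose i) * y (k - i) * x (Suc i)) =
          y 0 * x (Suc k) + (\<Sum>i\<le>k. (if i = 0 then 0 else of_nat (k choose (i - 1)) * y (k - (i - 1))) * x i)"
        (is "?l = _ + ?r")
      proof -
        have "?l + 0 = (\<Sum>i\<le>Suc k. (if i = 0 then 0 else of_nat (k choose (i - 1)) * y (k - (i - 1))) * x i)"
          unfolding sum.atMost_Suc_shift by (simp add: atLeast0AtMost)
        then show ?thesis by simp
      qed
      have "wronskian_jet y x k = (\<Sum>i=0..k. of_nat (k choose i) * y (k - i) * x (Suc i))
          - (\<Sum>i\<le>k. of_nat (k choose i) * y (Suc (k - i)) * x i)"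
        unfolding wronskian_jet_def atLeast0AtMost sum_subtractf[symmetric]
        by (rule sum.cong) (auto simp: algebra_simps)
      then show ?thesis unfolding * by (simp add: w_def left_diff_distrib sum_subtractf)
    qed
    have split: "(\<Sum>m\<le>Suc k. a m * x m) = (\<Sum>m\<le>k. a' m * x m) + c * wronskian_jet y x k" for x
    proof -
      have "c * (y 0 * x (Suc k)) = a (Suc k) * x (Suc k)" using assms(2) by (simp add: c_def)
      then show ?thesis unfolding W a'_def
        by (auto simp: left_diff_distrib sum_subtractf sum_distrib_left distrib_left mult.assoc)
    qed
    \<comment> \<open>By antisymmetry \<open>y\<close> stays in the kernel of the remainder
      \<open>a'\<close>. The base case is left with \<open>a 0 * y 0 = 0\<close>, so the final
      remainder vanishes.\<close>
    have "wronskian_jet y y k = 0"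
    proof -
      have "(\<Sum>i=0..k. of_nat (k choose i) * (y (Suc i) * y (k - i))) =
            (\<Sum>i=0..k. of_nat (k choose i) * (y i * y (Suc (k - i))))"
        by (rule sum.reindex_bij_witness[of _ "\<lambda>i. k - i" "\<lambda>i. k - i"])
          (auto simp: binomial_symmetric[symmetric] Suc_diff_le)
      then show ?thesis unfolding wronskian_jet_def by (simp add: right_diff_distrib sum_subtractf)
    qed
    with split[of y] Suc.prems have "(\<Sum>m\<le>k. a' m * y m) = 0" by simp
    from Suc.IH[OF this] obtain b where
      b: "\<And>x. (\<Sum>m\<le>k. a' m * x m) = (\<Sum>n<k. b n * wronskian_jet y x n)" by blast
    have "(\<Sum>m\<le>Suc k. a m * x m) = (\<Sum>n<Suc k. (b(k := c)) n * wronskian_jet y x n)" for x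
      unfolding split b by simp
    moreover have "(b(k := c)) (Suc k - 1) * y 0 = a (Suc k)"
      using assms(2) by (simp add: c_def)
    ultimately show ?case by blast
  qed
  then show ?thesis using that by blast
qed

lemma norm_wronskian_jet_le:
  assumes "\<And>m. m \<le> Suc n \<Longrightarrow> norm (y m) \<le> M" and "\<And>m. m \<le> Suc n \<Longrightarrow> norm (x m) \<le> 1"
  shows "norm (wronskian_jet y x n) \<le> 2 ^ Suc n * M"
proof -
  have M: "0 \<le> M" using assms(1)[of 0] norm_ge_zero order_trans by blast
  have t: "norm (x i * y j) \<le> M" if "i \<le> Suc n" "j \<le> Suc n" for i j
    using mult_mono[OF assms(2)[OF that(1)] assms(1)[OF that(2)]] by (simp add: norm_mult)
  have "norm (wronskian_jet y x n) \<le> (\<Sum>i=0..n. of_nat (n choose i) * (2 * M))"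
    unfolding wronskian_jet_def
  proof (rule sum_norm_le)
    fix i assume "i \<in> {0..n}"
    then have "norm (x (Suc i) * y (n - i) - x i * y (Suc (n - i))) \<le> M + M"
      by (intro norm_triangle_le_diff add_mono t) auto
    then show "norm (of_nat (n choose i) * (x (Suc i) * y (n - i) - x i * y (Suc (n - i))))
        \<le> of_nat (n choose i) * (2 * M)"
      by (simp add: norm_mult mult_left_mono)
  qed
  also have "\<dots> = of_nat (\<Sum>i\<le>n. n choose i) * (2 * M)"
    by (simp add: sum_distrib_right atLeast0AtMost)
  also have "\<dots> = 2 ^ Suc n * M" by (simp add: choose_row_sum)
  finally show ?thesis .
qed

text \<open>At a fixed \<open>z\<close> the equation is a linear form in jets. Dividing out
  \<open>g 0\<close> leaves a form of order one less that annihilates the reduced family, so its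
  coefficients are bounded by induction. The bound \<open>q\<close> on derivative orders stays fixed
  so that the hypotheses pass to the reduced family.\<close>

lemma coefficient_bound:
  assumes "k \<le> q" and "B \<ge> 1"
    and "\<And>i. g i holomorphic_on UNIV" and "a k = 1"
    and "\<And>i. i < k \<Longrightarrow> (\<Sum>m\<le>k. a m * (deriv ^^ m) (g i) z) = 0"
    and "\<And>n. n < k \<Longrightarrow> (order_red ^^ n) g 0 z \<noteq> 0"
    and "\<And>n m. n < k \<Longrightarrow> m \<le> q \<Longrightarrow>
       norm ((deriv ^^ m) ((order_red ^^ n) g 0) z) \<le> B * norm ((order_red ^^ n) g 0 z)"
    and "m \<le> k"
  shows "norm (a m) \<le> (real q * 2 ^ q * B) ^ k"
  using assms
proof (induction k arbitrary: a g m)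
  case 0
  then show ?case by simp
next
  case (Suc k)
  define y where "y m = (deriv ^^ m) (g 0) z" for m
  define K where "K = real q * 2 ^ q * B"
  have y0: "y 0 \<noteq> 0" using Suc.prems(6)[of 0] by (simp add: y_def)
  have yB: "norm (y m) \<le> B * norm (y 0)" if "m \<le> q" for m
    using Suc.prems(7)[of 0 m] that by (simp add: y_def)
  have "(\<Sum>m\<le>Suc k. a m * y m) = 0" using Suc.prems(5)[of 0] by (simp add: y_def)
  from linear_form_factor[OF this y0] obtain b where
    b: "\<And>x. (\<Sum>m\<le>Suc k. a m * x m) = (\<Sum>n<Suc k. b n * wronskian_jet y x n)"
    and bk: "b k * y 0 = a (Suc k)" by auto
  have bn: "norm (b n * y 0) \<le> K ^ k" if "n \<le> k" for n
    unfolding K_def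
  \<comment> \<open>The factor \<open>y 0\<close> makes the reduced form monic, by
    \<open>bk\<close>. Below it cancels against \<open>norm (y 0)\<close> in the bound for the
    Wronskian.\<close>
  proof (rule Suc.IH[of "order_red g" "\<lambda>n. b n * y 0"])
    show "order_red g i holomorphic_on UNIV" for i
      by (rule holomorphic_order_red) (rule Suc.prems)
    show "(\<Sum>m\<le>k. b m * y 0 * (deriv ^^ m) (order_red g i) z) = 0" if "i < k" for i
    proof -
      have "(\<Sum>m\<le>k. b m * y 0 * (deriv ^^ m) (order_red g i) z) =
         y 0 * (\<Sum>m<Suc k. b m * (deriv ^^ m) (order_red g i) z)"
        by (simp add: sum_distrib_left mult_ac lessThan_Suc_atMost)
      also have "(\<Sum>m<Suc k. b m * (deriv ^^ m) (order_red g i) z) =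
         (\<Sum>m\<le>Suc k. a m * (deriv ^^ m) (g (Suc i)) z)"
        unfolding b higher_deriv_order_red[OF Suc.prems(3)] y_def ..
      also have "\<dots> = 0" using Suc.prems(5)[of "Suc i"] that by simp
      finally show ?thesis by simp
    qed
  qed (use Suc.prems that bk Suc.prems(6,7)[of "Suc _"] in \<open>auto simp: funpow_swap1\<close>)
  \<comment> \<open>Testing the factorization with a unit vector isolates
    \<open>a m\<close>.\<close>
  define x where "x i = (if i = m then 1 else 0 :: complex)" for i
  have "a m = (\<Sum>i\<le>Suc k. if i = m then a i else 0)" using Suc.prems(8) by simp
  also have "\<dots> = (\<Sum>i\<le>Suc k. a i * x i)" by (rule sum.cong) (auto simp: x_def)
  also have "\<dots> = (\<Sum>n<Suc k. b n * wronskian_jet y x n)" by (rule b)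
  finally have "norm (a m) \<le> (\<Sum>n<Suc k. norm (b n * wronskian_jet y x n))"
    by (metis norm_sum)
  also have "\<dots> \<le> (\<Sum>n<Suc k. K ^ k * (2 ^ q * B))"
  proof (rule sum_mono)
    fix n assume "n \<in> {..<Suc k}"
    then have n: "n \<le> k" "Suc n \<le> q" using Suc.prems(1) by auto
    have "norm (wronskian_jet y x n) \<le> 2 ^ Suc n * (B * norm (y 0))"
      by (rule norm_wronskian_jet_le) (use n yB in \<open>auto simp: x_def\<close>)
    also have "\<dots> \<le> 2 ^ q * (B * norm (y 0))"
      using n Suc.prems(2) by (intro mult_right_mono power_increasing) auto
    finally have "norm (b n * wronskian_jet y x n) \<le> norm (b n) * (2 ^ q * (B * norm (y 0)))"
      by (simp add: norm_mult mult_left_mono)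
    also have "\<dots> = norm (b n * y 0) * (2 ^ q * B)" by (simp add: norm_mult)
    also have "\<dots> \<le> K ^ k * (2 ^ q * B)"
      using bn[OF n(1)] Suc.prems(2) by (intro mult_right_mono) auto
    finally show "norm (b n * wronskian_jet y x n) \<le> K ^ k * (2 ^ q * B)" .
  qed
  also have "\<dots> = real (Suc k) * (K ^ k * (2 ^ q * B))" by simp
  also have "\<dots> \<le> real q * (K ^ k * (2 ^ q * B))"
    using Suc.prems(1,2) by (intro mult_right_mono) (auto simp: K_def)
  also have "\<dots> = (real q * 2 ^ q * B) ^ Suc k" by (simp add: K_def)
  finally show ?case .
qed

section \<open>Linear differential equations with entire coefficients\<close>

text \<open>Integrating along the radius gains the factor \<open>1 / Suc n\<close>; these factors
  build up the factorial in the Picard estimate.\<close>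

lemma primitive_bound:
  fixes w g :: "complex \<Rightarrow> complex" and C R :: real
  assumes "\<And>z. norm z \<le> R \<Longrightarrow> norm (w z) \<le> C * norm z ^ n"
    and "\<And>z. (g has_field_derivative w z) (at z)" and "g 0 = 0" and "norm z \<le> R"
  shows "norm (g z) \<le> C * norm z ^ Suc n / Suc n"
proof -
  have "(w has_contour_integral g z) (linepath 0 z)"
    using contour_integral_primitive[of UNIV g w "linepath 0 z"] assms(2,3) by simp
  then have I: "((\<lambda>x. w (linepath 0 z x) * (z - 0)) has_integral g z) {0..1}"
    unfolding has_contour_integral_linepath .
  have "norm (g z) \<le> integral {0..1} (\<lambda>x::real. C * norm z ^ Suc n * x ^ n)"
    unfolding integral_unique[OF I, symmetric]
  proof (rule integral_norm_bound_integral)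
    show "(\<lambda>x. w (linepath 0 z x) * (z - 0)) integrable_on {0..1}"
      using I by (rule has_integral_integrable)
    show "(\<lambda>x::real. C * norm z ^ Suc n * x ^ n) integrable_on {0..1}"
      by (intro integrable_continuous_interval continuous_intros)
    fix x :: real assume x: "x \<in> {0..1}"
    have n: "norm (linepath 0 z x) = x * norm z"
      using x by (simp add: linepath_def)
    have "x * norm z \<le> R" using mult_right_mono[of x 1 "norm z"] x assms(4) by simp
    then have "norm (w (linepath 0 z x)) \<le> C * (x * norm z) ^ n"
      using assms(1)[of "linepath 0 z x"] unfolding n by simp
    then have "norm (w (linepath 0 z x)) * norm z \<le> C * (x * norm z) ^ n * norm z"
      by (rule mult_right_mono) simp
    then show "norm (w (linepath 0 z x) * (z - 0)) \<le> C * norm z ^ Suc n * x ^ n"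
      by (simp add: norm_mult power_mult_distrib mult_ac)
  qed
  also have "integral {0..1} (\<lambda>x::real. C * norm z ^ Suc n * x ^ n) = C * norm z ^ Suc n / Suc n"
  proof -
    have "((\<lambda>x::real. C * norm z ^ Suc n * x ^ n) has_integral
        (C * norm z ^ Suc n / Suc n * 1 ^ Suc n - C * norm z ^ Suc n / Suc n * 0 ^ Suc n)) {0..1}"
    proof (rule fundamental_theorem_of_calculus)
      fix x :: real
      have "((\<lambda>x. C * norm z ^ Suc n / Suc n * x ^ Suc n) has_real_derivative
         C * norm z ^ Suc n / Suc n * (real (Suc n) * x ^ n)) (at x within {0..1})"
        by (auto intro!: derivative_eq_intros simp del: power_Suc)
      moreover have "C * norm z ^ Suc n / Suc n * (real (Suc n) * x ^ n) = C * norm z ^ Suc n * x ^ n"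
        by (simp del: of_nat_Suc)
      ultimately show "((\<lambda>x. C * norm z ^ Suc n / Suc n * x ^ Suc n) has_vector_derivative
         C * norm z ^ Suc n * x ^ n) (at x within {0..1})"
        by (simp only: has_real_derivative_iff_has_vector_derivative)
    qed simp
    then have "((\<lambda>x::real. C * norm z ^ Suc n * x ^ n) has_integral C * norm z ^ Suc n / Suc n) {0..1}"
      by simp
    then show ?thesis by (rule integral_unique)
  qed
  finally show ?thesis .
qed

lemma primitive_from_0:
  fixes w :: "complex \<Rightarrow> complex"
  assumes "w holomorphic_on UNIV"
  obtains g where "\<And>z. (g has_field_derivative w z) (at z)" "g 0 = 0"
proof -
  obtain g where g: "\<And>x. (g has_field_derivative w x) (at x)"
    using holomorphic_convex_primitive'[OF convex_UNIV open_UNIV assms] by auto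
  have "((\<lambda>z. g z - g 0) has_field_derivative w z) (at z)" for z
    using DERIV_diff[OF g[of z] DERIV_const[of "g 0"]] by simp
  then show ?thesis using that[of "\<lambda>z. g z - g 0"] by simp
qed

text \<open>Picard iteration: \<open>E n\<close> are the increments of the successive approximations.\<close>

lemma linear_system_solution:
  fixes M :: "nat \<Rightarrow> nat \<Rightarrow> complex \<Rightarrow> complex"
  assumes M: "\<And>i j. i < k \<Longrightarrow> j < k \<Longrightarrow> M i j holomorphic_on UNIV"
  obtains y where "\<And>i z. i < k \<Longrightarrow> (y i has_field_derivative (\<Sum>j<k. M i j z * y j z)) (at z)"
    and "\<And>i. i < k \<Longrightarrow> y i 0 = c i"
proof -
  define P where "P w = (SOME g. (\<forall>z. (g has_field_derivative w z) (at z)) \<and> g 0 = (0::complex))"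
    for w :: "complex \<Rightarrow> complex"
  have P: "(P w has_field_derivative w z) (at z)" "P w 0 = 0" if "w holomorphic_on UNIV" for w z
  proof -
    have "\<exists>g. (\<forall>z. (g has_field_derivative w z) (at z)) \<and> g 0 = 0"
      using primitive_from_0[OF that] by blast
    from someI_ex[OF this] show "(P w has_field_derivative w z) (at z)" "P w 0 = 0"
      unfolding P_def by auto
  qed
  define E where "E = rec_nat (\<lambda>i z. c i) (\<lambda>n e i. P (\<lambda>z. \<Sum>j<k. M i j z * e j z))"
  have E0: "E 0 i = (\<lambda>z. c i)" for i by (simp add: E_def)
  have ES: "E (Suc n) i = P (\<lambda>z. \<Sum>j<k. M i j z * E n j z)" for n i by (simp add: E_def)
  have holE: "E n i holomorphic_on UNIV" if "i < k" for n i
    using that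
  proof (induction n arbitrary: i)
    case 0
    then show ?case by (simp add: E0)
  next
    case (Suc n)
    have "(\<lambda>z. \<Sum>j<k. M i j z * E n j z) holomorphic_on UNIV"
      by (intro holomorphic_intros M Suc) auto
    from P(1)[OF this] show ?case unfolding ES
      by (meson holomorphic_on_def field_differentiable_def DERIV_subset subset_UNIV)
  qed
  have holS: "(\<lambda>z. \<Sum>j<k. M i j z * E n j z) holomorphic_on UNIV" if "i < k" for i n
    by (intro holomorphic_intros M holE that) auto
  have derE: "(E (Suc n) i has_field_derivative (\<Sum>j<k. M i j z * E n j z)) (at z)"
    if "i < k" for i n z
    unfolding ES by (rule P(1)[OF holS[OF that]])
  have E_at_0: "E (Suc n) i 0 = 0" if "i < k" for i n
    unfolding ES by (rule P(2)[OF holS[OF that]])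
  have bound: "\<exists>C L. C \<ge> 0 \<and> L \<ge> 0 \<and> (\<forall>n. \<forall>i<k. \<forall>z. norm z \<le> R \<longrightarrow> norm (E n i z) \<le> C * (L * norm z) ^ n / fact n)"
    if R: "R > 0" for R
  proof -
    have "\<exists>m. \<forall>z\<in>cball 0 R. norm (M i j z) \<le> m" if "i < k" "j < k" for i j
    proof -
      have "continuous_on (cball 0 R) (M i j)"
        using M[OF that] holomorphic_on_imp_continuous_on holomorphic_on_subset by blast
      from compact_imp_bounded[OF compact_continuous_image[OF this compact_cball]]
      show ?thesis unfolding bounded_iff by blast
    qed
    note ex = this
    define m where "m i j = (SOME m. \<forall>z\<in>cball 0 R. norm (M i j z) \<le> m)" for i j
    have m: "norm (M i j z) \<le> m i j" if "i < k" "j < k" "norm z \<le> R" for i j z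
      using someI_ex[OF ex[OF that(1,2)]] that(3) unfolding m_def by auto
    have m0: "m i j \<ge> 0" if "i < k" "j < k" for i j
      using order_trans[OF norm_ge_zero m[OF that, of 0]] R by simp
    define mu where "mu = (\<Sum>i<k. \<Sum>j<k. m i j)"
    have mu: "m i j \<le> mu" if "i < k" "j < k" for i j
    proof -
      have "m i j \<le> (\<Sum>j<k. m i j)" using that m0 by (intro member_le_sum) auto
      also have "\<dots> \<le> mu" unfolding mu_def using that m0
        by (intro member_le_sum[of i _ "\<lambda>i. \<Sum>j<k. m i j"] sum_nonneg) auto
      finally show ?thesis .
    qed
    have mu0: "mu \<ge> 0" unfolding mu_def by (intro sum_nonneg m0) auto
    define C where "C = (\<Sum>i<k. norm (c i))"
    have C0: "C \<ge> 0" unfolding C_def by (intro sum_nonneg) auto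
    \<comment> \<open>Each increment is a primitive of a sum of \<open>k\<close> products, each at
      most \<open>mu\<close> times the previous bound.\<close>
    define L where "L = k * mu"
    have L0: "L \<ge> 0" using mu0 by (simp add: L_def)
    have "norm (E n i z) \<le> C * (L * norm z) ^ n / fact n" if "i < k" "norm z \<le> R" for n i z
      using that
    proof (induction n arbitrary: i z)
      case 0
      then show ?case unfolding E0 C_def
        using member_le_sum[of i "{..<k}" "\<lambda>i. norm (c i)"] by simp
    next
      case (Suc n)
      have b: "norm (\<Sum>j<k. M i j z * E n j z) \<le> C * L ^ Suc n / fact n * norm z ^ n"
        if "norm z \<le> R" for z
      proof -
        have "norm (\<Sum>j<k. M i j z * E n j z) \<le> (\<Sum>j<k. mu * (C * (L * norm z) ^ n / fact n))"
        proof (rule sum_norm_le)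
          fix j assume "j \<in> {..<k}"
          then have j: "j < k" by simp
          have "norm (M i j z) \<le> mu"
            using m[OF Suc.prems(1) j that] mu[OF Suc.prems(1) j] by linarith
          then show "norm (M i j z * E n j z) \<le> mu * (C * (L * norm z) ^ n / fact n)"
            unfolding norm_mult by (intro mult_mono Suc.IH[OF j that]) (use mu0 in auto)
        qed
        also have "\<dots> = L * (C * (L * norm z) ^ n / fact n)" by (simp add: L_def)
        also have "\<dots> = C * L ^ Suc n / fact n * norm z ^ n" by (simp add: power_mult_distrib mult_ac)
        finally show ?thesis .
      qed
      have "norm (E (Suc n) i z) \<le> C * L ^ Suc n / fact n * norm z ^ Suc n / Suc n"
        using primitive_bound[OF b derE[OF Suc.prems(1)] E_at_0[OF Suc.prems(1)] Suc.prems(2)]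
        by simp
      then show ?case by (simp add: power_mult_distrib mult_ac)
    qed
    then show ?thesis using C0 L0 by blast
  qed
  \<comment> \<open>The first approximation is constant, hence the 0. The shift by one makes the
    differentiated series equal to the matrix applied to the series itself.\<close>
  define E' where "E' n i z = (case n of 0 \<Rightarrow> 0 | Suc n \<Rightarrow> \<Sum>j<k. M i j z * E n j z)" for n i z
  have "\<exists>g g'. \<forall>z\<in>UNIV. ((\<lambda>n. E n i z) sums g z) \<and> ((\<lambda>n. E' n i z) sums g' z) \<and> (g has_field_derivative g' z) (at z)"
    if i: "i < k" for i
  \<comment> \<open>On a unit ball around any point the increments are dominated by the terms of an
    exponential series, which justifies termwise differentiation.\<close>
  proof (rule series_and_derivative_comparison_local[OF open_UNIV])
    show "(E n i has_field_derivative E' n i z) (at z)" for n z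
      using derE[OF i] by (cases n) (auto simp: E0 E'_def)
    fix x :: complex
    obtain C L where CL: "C \<ge> 0" "L \<ge> 0"
      and le: "\<And>n z. norm z \<le> norm x + 1 \<Longrightarrow> norm (E n i z) \<le> C * (L * norm z) ^ n / fact n"
      using bound[of "norm x + 1"] i by (metis add_nonneg_pos norm_ge_zero zero_less_one)
    have "summable (\<lambda>n. C * ((L * (norm x + 1)) ^ n /\<^sub>R fact n))"
      by (intro summable_mult summable_exp_generic)
    moreover have "norm (E n i y) \<le> C * ((L * (norm x + 1)) ^ n /\<^sub>R fact n)" if "y \<in> ball x 1" for n y
    proof -
      have "norm y \<le> norm x + 1"
        using that norm_triangle_ineq3[of x y] by (auto simp: dist_norm)
      then have "norm (E n i y) \<le> C * (L * norm y) ^ n / fact n" by (rule le)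
      also have "\<dots> \<le> C * (L * (norm x + 1)) ^ n / fact n"
        using \<open>norm y \<le> norm x + 1\<close> CL by (intro divide_right_mono mult_left_mono power_mono) auto
      finally show ?thesis by (simp add: field_simps)
    qed
    ultimately show "\<exists>d h. 0 < d \<and> summable h \<and>
        (\<forall>\<^sub>F n in sequentially. \<forall>y\<in>ball x d \<inter> UNIV. norm (E n i y) \<le> h n)"
      by (intro exI[of _ 1] exI[of _ "\<lambda>n. C * ((L * (norm x + 1)) ^ n /\<^sub>R fact n)"]) auto
  qed
  note ex = this
  define y where "y i z = (\<Sum>n. E n i z)" for i z
  define y' where "y' i z = (\<Sum>n. E' n i z)" for i z
  have y: "(\<lambda>n. E n i z) sums y i z" "(\<lambda>n. E' n i z) sums y' i z"
    "(y i has_field_derivative y' i z) (at z)" if i: "i < k" for i z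
  proof -
    obtain g g' where g: "\<And>z. (\<lambda>n. E n i z) sums g z" "\<And>z. (\<lambda>n. E' n i z) sums g' z"
      "\<And>z. (g has_field_derivative g' z) (at z)"
      using ex[OF i] by auto
    have "y i = g" "y' i = g'" using g by (auto simp: y_def y'_def sums_iff fun_eq_iff)
    then show "(\<lambda>n. E n i z) sums y i z" "(\<lambda>n. E' n i z) sums y' i z"
      "(y i has_field_derivative y' i z) (at z)" using g by auto
  qed
  have "y' i z = (\<Sum>j<k. M i j z * y j z)" if "i < k" for i z
  proof -
    have "(\<lambda>n. E' (Suc n) i z) sums (\<Sum>j<k. M i j z * y j z)"
      unfolding E'_def nat.case by (intro sums_sum sums_mult y) auto
    then have "(\<lambda>n. E' n i z) sums (\<Sum>j<k. M i j z * y j z)"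
      using sums_Suc_iff[of "\<lambda>n. E' n i z"] by (simp add: E'_def)
    then show ?thesis using y(2)[OF that] sums_unique2 by blast
  qed
  moreover have "y i 0 = c i" if "i < k" for i
  proof -
    have "(\<lambda>n. E n i 0) sums E 0 i 0"
      using sums_finite[of "{0}" "\<lambda>n. E n i 0"] E_at_0[OF that] by (auto simp: gr0_conv_Suc)
    from sums_unique2[OF y(1)[OF that, of 0] this] show ?thesis by (simp add: E0)
  qed
  ultimately show ?thesis using that[of y] y(3) by simp
qed

section \<open>Scalar equations of order \<open>k\<close>\<close>

lemma iterated_deriv_chain:
  assumes "\<And>i z. Suc i < k \<Longrightarrow> (y i has_field_derivative y (Suc i) z) (at z)" and "m < k"
  shows "(deriv ^^ m) (y 0) = y m"
  using assms(2)
proof (induction m)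
  case (Suc m)
  then have "(deriv ^^ Suc m) (y 0) = deriv (y m)" by simp
  also have "\<dots> = y (Suc m)" using assms(1)[OF Suc.prems] by (auto intro!: DERIV_imp_deriv)
  finally show ?case .
qed simp

lemma linear_ode_solution:
  assumes A: "\<And>j. j < k \<Longrightarrow> A j holomorphic_on UNIV" and "k > 0"
  obtains f where "f holomorphic_on UNIV" "\<And>z. lin_diff_op k A f z = 0"
    "\<And>m. m < k \<Longrightarrow> (deriv ^^ m) f 0 = c m"
proof -
  \<comment> \<open>The companion matrix: component \<open>i\<close> of the system becomes the
    \<open>i\<close>-th derivative, and the last row carries the equation.\<close>
  define M where "M i j = (if Suc i < k then (\<lambda>z. if j = Suc i then 1 else 0) else (\<lambda>z. - A j z))" for i j
  have "M i j holomorphic_on UNIV" if "i < k" "j < k" for i j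
    using A[OF that(2)] by (auto simp: M_def intro!: holomorphic_intros)
  from linear_system_solution[where k = k and M = M and c = c, OF this] obtain y where
    y: "\<And>i z. i < k \<Longrightarrow> (y i has_field_derivative (\<Sum>j<k. M i j z * y j z)) (at z)"
    and y0: "\<And>i. i < k \<Longrightarrow> y i 0 = c i" by blast
  have "(\<Sum>j<k. M i j z * y j z) = y (Suc i) z" if "Suc i < k" for i z
  proof -
    have "(\<Sum>j<k. M i j z * y j z) = (\<Sum>j<k. if j = Suc i then y (Suc i) z else 0)"
      by (rule sum.cong) (auto simp: M_def that)
    then show ?thesis using that by simp
  qed
  then have chain: "(y i has_field_derivative y (Suc i) z) (at z)" if "Suc i < k" for i z
    using y[of i z] that by simp
  have d: "(deriv ^^ m) (y 0) = y m" if "m < k" for m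
    using iterated_deriv_chain[of k y, OF chain that] .
  obtain l where l: "k = Suc l" using assms(2) by (metis gr0_implies_Suc)
  have hol: "y 0 holomorphic_on UNIV"
    unfolding holomorphic_on_def field_differentiable_def
    using y[OF assms(2)] DERIV_subset by blast
  have "lin_diff_op k A (y 0) z = 0" for z
  proof -
    have "(deriv ^^ k) (y 0) z = deriv (y l) z" using d[of l] by (simp add: l)
    also have "\<dots> = (\<Sum>j<k. M l j z * y j z)" using y[of l z] by (auto simp: l intro: DERIV_imp_deriv)
    also have "\<dots> = - (\<Sum>j<k. A j z * (deriv ^^ j) (y 0) z)"
      unfolding sum_negf[symmetric] by (rule sum.cong) (auto simp: M_def l d)
    finally show ?thesis by (simp add: lin_diff_op_def)
  qed
  then show ?thesis using that[OF hol] d y0 by auto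
qed

text \<open>Gronwall's argument along the ray from 0 to \<open>z\<close>, for the squared Euclidean
  norm of the jet, which remains differentiable where the jet vanishes. The summand 1 in the
  hypothesis on \<open>mu\<close> covers the components whose derivative is just the next
  component.\<close>

lemma norm_solution_le:
  assumes f: "f holomorphic_on UNIV" and L: "\<And>z. lin_diff_op k A f z = 0"
    and mu: "\<And>z. norm z \<le> r \<Longrightarrow> 1 + (\<Sum>j<k. norm (A j z)) \<le> mu" and "k > 0"
    and "norm z \<le> r"
  shows "norm (f z) \<le> sqrt (\<Sum>j<k. (norm ((deriv ^^ j) f 0))\<^sup>2) * exp (k * mu * r)"
proof -
  \<comment> \<open>For \<open>z = 0\<close> any direction serves; the value 1 keeps the modulus
    equal to 1.\<close>
  define e where "e = (if z = 0 then 1 else z / norm z)"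
  have e: "norm e = 1" "norm z *\<^sub>R e = z"
    by (auto simp: e_def norm_divide scaleR_conv_of_real)
  define y where "y j t = (deriv ^^ j) f (t *\<^sub>R e)" for j and t :: real
  define N where "N t = (\<Sum>j<k. (norm (y j t))\<^sup>2)" for t
  define N' where "N' t = (\<Sum>j<k. 2 * (y j t \<bullet> (e * y (Suc j) t)))" for t
  have mu1: "mu \<ge> 1" using mu[of z] assms(5) sum_nonneg[of "{..<k}" "\<lambda>j. norm (A j z)"] by auto
  have dy: "(y j has_vector_derivative e * y (Suc j) t) (at t)" for j t
  proof -
    have "((deriv ^^ j) f has_field_derivative (deriv ^^ Suc j) f (t *\<^sub>R e)) (at (t *\<^sub>R e))"
      using has_field_derivative_higher_deriv[OF f open_UNIV] by blast
    moreover have "((\<lambda>t. t *\<^sub>R e) has_vector_derivative e) (at t)"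
      by (auto intro!: derivative_eq_intros)
    ultimately show ?thesis
      using field_vector_diff_chain_at[of "\<lambda>t. t *\<^sub>R e" e t "(deriv ^^ j) f"]
      unfolding y_def o_def by auto
  qed
  have dN: "(N has_real_derivative N' t) (at t)" for t
  proof -
    have "((\<lambda>t. y j t \<bullet> y j t) has_vector_derivative 2 * (y j t \<bullet> (e * y (Suc j) t))) (at t)" for j
      using bounded_bilinear.has_vector_derivative[OF bounded_bilinear_inner dy[of j t] dy[of j t]]
      by (simp add: inner_commute)
    then show ?thesis unfolding N_def N'_def power2_norm_eq_inner has_real_derivative_iff_has_vector_derivative
      by (intro has_vector_derivative_sum) auto
  qed
  have bN: "N' t \<le> 2 * k * mu * N t" if "0 \<le> t" "t \<le> norm z" for t
  proof -
    define S where "S = (\<Sum>j<k. norm (y j t))"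
    have S0: "norm (y j t) \<le> S" if "j < k" for j
      unfolding S_def by (rule member_le_sum[of j _ "\<lambda>j. norm (y j t)"]) (use that in auto)
    have Sp: "S \<ge> 0" unfolding S_def by (intro sum_nonneg) auto
    have nt: "norm (t *\<^sub>R e) \<le> r" using that e assms(5) by simp
    have b: "norm (y (Suc j) t) \<le> mu * S" if "j < k" for j
    proof (cases "Suc j < k")
      case True
      then show ?thesis using S0[OF True] mult_right_mono[OF mu1 Sp] by simp
    next
      case False
      then have "Suc j = k" using that by simp
      then have "y (Suc j) t = - (\<Sum>i<k. A i (t *\<^sub>R e) * y i t)"
        using L[of "t *\<^sub>R e"] by (simp add: lin_diff_op_def y_def add_eq_0_iff2 del: funpow.simps)
      then have "norm (y (Suc j) t) \<le> (\<Sum>i<k. norm (A i (t *\<^sub>R e)) * S)"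
        by (auto intro!: sum_norm_le mult_left_mono S0 simp: norm_mult)
      also have "\<dots> \<le> mu * S"
        unfolding sum_distrib_right[symmetric] using mu[OF nt] Sp by (intro mult_right_mono) auto
      finally show ?thesis .
    qed
    have "N' t \<le> (\<Sum>j<k. 2 * (norm (y j t) * (mu * S)))"
      unfolding N'_def
    proof (intro sum_mono mult_left_mono)
      fix j assume "j \<in> {..<k}"
      then have "norm (e * y (Suc j) t) \<le> mu * S" using b e by (simp add: norm_mult)
      then show "y j t \<bullet> (e * y (Suc j) t) \<le> norm (y j t) * (mu * S)"
        using norm_cauchy_schwarz[of "y j t" "e * y (Suc j) t"]
        by (meson mult_left_mono norm_ge_zero order_trans)
    qed auto
    also have "\<dots> = 2 * mu * S\<^sup>2"
      by (simp add: S_def power2_eq_square sum_distrib_left sum_distrib_right mult_ac)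
    also have "\<dots> \<le> 2 * mu * (k * N t)"
    proof (rule mult_left_mono)
      show "S\<^sup>2 \<le> k * N t"
        unfolding S_def N_def using Cauchy_Schwarz_ineq_sum[of "\<lambda>_. 1" "\<lambda>j. norm (y j t)" "{..<k}"] by simp
    qed (use mu1 in auto)
    finally show ?thesis by (simp add: mult_ac)
  qed
  \<comment> \<open>With this integrating factor \<open>bN\<close> says that \<open>h\<close> does
    not increase. The 2 in the exponent disappears with the final square root.\<close>
  define h where "h t = N t * exp (- (2 * k * mu * t))" for t
  have "h (norm z) \<le> h 0"
  proof (rule DERIV_nonpos_imp_nonincreasing[of 0 "norm z" h])
    fix t assume t: "0 \<le> t" "t \<le> norm z"
    have "(h has_real_derivative (N' t - 2 * k * mu * N t) * exp (- (2 * k * mu * t))) (at t)"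
      unfolding h_def by (rule derivative_eq_intros dN refl)+ (simp add: algebra_simps)
    moreover have "(N' t - 2 * k * mu * N t) * exp (- (2 * k * mu * t)) \<le> 0"
      using bN[OF t] by (simp add: mult_nonpos_nonneg)
    ultimately show "\<exists>y. DERIV h t :> y \<and> y \<le> 0" by blast
  qed simp
  then have "N (norm z) \<le> N 0 * exp (2 * k * mu * norm z)"
    by (simp add: h_def exp_minus field_simps)
  also have "\<dots> \<le> N 0 * exp (2 * k * mu * r)"
    using assms(5) mu1 by (intro mult_left_mono) (auto simp: N_def intro!: mult_left_mono sum_nonneg)
  finally have NN: "N (norm z) \<le> N 0 * exp (2 * k * mu * r)" .
  have "(norm (f z))\<^sup>2 \<le> N (norm z)"
    unfolding N_def using member_le_sum[of 0 "{..<k}" "\<lambda>j. (norm (y j (norm z)))\<^sup>2"] assms(4) e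
    by (simp add: y_def)
  also note NN
  also have "N 0 * exp (2 * k * mu * r) = (sqrt (N 0) * exp (k * mu * r))\<^sup>2"
    by (simp add: power_mult_distrib N_def sum_nonneg exp_double[symmetric] mult_ac)
  finally have "norm (f z) \<le> sqrt (N 0) * exp (k * mu * r)"
    by (rule power2_le_imp_le) (auto simp: N_def intro!: sum_nonneg mult_nonneg_nonneg)
  then show ?thesis by (simp add: N_def y_def)
qed

section \<open>The characteristic of an entire function\<close>

lemma nevanlinna_T_entire:
  assumes "f holomorphic_on UNIV"
  shows "nevanlinna_T r f = proximity_function r f"
proof -
  have "\<not> is_pole f z" for z
    by (rule analytic_at_imp_no_pole)
      (meson analytic_on_holomorphic assms open_UNIV subset_UNIV)
  then show ?thesis by (simp add: nevanlinna_T_def counting_function_def pole_count_def)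
qed

text \<open>Here the logarithm is only taken of numbers at least 1, which gives continuity also
  where the function has zeros.\<close>

lemma log_plus_eq: "x \<ge> 0 \<Longrightarrow> log_plus x = ln (max 1 x)"
  by (cases "x = 0") (auto simp: log_plus_def max_def ln_ge_iff)

lemma log_plus_nonneg: "log_plus x \<ge> 0"
  by (simp add: log_plus_def)

lemma continuous_on_log_plus_norm:
  assumes "continuous_on S f"
  shows "continuous_on S (\<lambda>x. log_plus (norm (f x)))"
proof -
  have "continuous_on S (\<lambda>x. ln (max 1 (norm (f x))))"
    by (intro continuous_intros assms) (auto simp: max_def)
  then show ?thesis by (simp add: log_plus_eq)
qed

lemma le_exp_log_plus: "x \<ge> 0 \<Longrightarrow> x \<le> exp (log_plus x)"
  by (simp add: log_plus_eq)

lemma log_plus_le: "x \<ge> 0 \<Longrightarrow> x \<le> exp B \<Longrightarrow> B \<ge> 0 \<Longrightarrow> log_plus x \<le> B"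
  using ln_le_cancel_iff[of x "exp B"] by (cases "x = 0") (auto simp: log_plus_def)

lemma continuous_on_circle:
  assumes "f holomorphic_on UNIV"
  shows "continuous_on S (\<lambda>\<theta>. f (of_real r * cis \<theta>))"
proof -
  have "continuous_on UNIV f" using assms by (rule holomorphic_on_imp_continuous_on)
  then show ?thesis
    by (rule continuous_on_compose2) (auto intro!: continuous_intros)
qed

lemma proximity_function_le:
  assumes "f holomorphic_on UNIV" and "B \<ge> 0"
    and "\<And>z. norm z = \<bar>r\<bar> \<Longrightarrow> norm (f z) \<le> exp B"
  shows "proximity_function r f \<le> B"
proof -
  have "integral {0..2 * pi} (\<lambda>\<theta>. log_plus (norm (f (of_real r * cis \<theta>)))) \<le> integral {0..2 * pi} (\<lambda>\<theta>. B)"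
  proof (rule integral_le)
    show "(\<lambda>\<theta>. log_plus (norm (f (of_real r * cis \<theta>)))) integrable_on {0..2 * pi}"
      by (intro integrable_continuous_interval continuous_on_log_plus_norm continuous_on_circle assms)
    fix \<theta>
    show "log_plus (norm (f (of_real r * cis \<theta>))) \<le> B"
      by (rule log_plus_le) (use assms in \<open>auto simp: norm_mult\<close>)
  qed auto
  then show ?thesis by (simp add: proximity_function_def field_simps)
qed

section \<open>Schwarz, Harnack and Borel-Caratheodory estimates\<close>

text \<open>The Moebius map sending \<open>a\<close> to \<open>(a - h 0) / (a + cnj (h 0))\<close>
  takes the right half-plane to the unit disc and \<open>h 0\<close> to 0. The Schwarz lemma applies
  to its composition with the rescaled \<open>h\<close>.\<close>

lemma schwarz_right_half_plane:
  assumes h: "h holomorphic_on ball 0 R" and pos: "\<And>z. norm z < R \<Longrightarrow> Re (h z) > 0"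
    and z: "norm z < R"
  shows "norm (h z - h 0) \<le> norm z / R * norm (h z + cnj (h 0))"
proof -
  have R: "R > 0" using z norm_ge_zero le_less_trans by blast
  define w where "w u = (h (R * u) - h 0) / (h (R * u) + cnj (h 0))" for u :: complex
  have in_ball: "norm (R * u) < R" if "norm u < 1" for u :: complex
    using that R by (simp add: norm_mult)
  have h0: "Re (h 0) > 0" using pos[of 0] R by simp
  have nz: "h (R * u) + cnj (h 0) \<noteq> 0" if "norm u < 1" for u :: complex
    using pos[OF in_ball[OF that]] h0 by (auto simp: complex_eq_iff)
  have "w holomorphic_on ball 0 1"
  proof -
    have "(\<lambda>u. h (R * u)) holomorphic_on ball 0 1"
      using holomorphic_on_compose_gen[of "\<lambda>u. R * u" "ball 0 1" h "ball 0 R", OF _ h] in_ball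
      by (simp add: o_def image_subset_iff holomorphic_intros)
    then show ?thesis unfolding w_def using nz by (auto intro!: holomorphic_intros)
  qed
  moreover have "w 0 = 0" by (simp add: w_def)
  moreover have "norm (w u) < 1" if "norm u < 1" for u :: complex
  proof -
    let ?a = "h (R * u)"
    have "(norm (?a - h 0))\<^sup>2 + 4 * Re ?a * Re (h 0) = (norm (?a + cnj (h 0)))\<^sup>2"
      unfolding cmod_power2 by (simp add: power2_eq_square algebra_simps)
    then have "(norm (?a - h 0))\<^sup>2 < (norm (?a + cnj (h 0)))\<^sup>2"
      using mult_pos_pos[OF pos[OF in_ball[OF that]] h0] by linarith
    then have "norm (?a - h 0) < norm (?a + cnj (h 0))"
      by (rule power2_less_imp_less) simp
    then show ?thesis unfolding w_def norm_divide by (simp add: divide_less_eq)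
  qed
  moreover have zR: "norm (z / R) < 1" using z R by (simp add: norm_divide)
  ultimately have "norm (w (z / R)) \<le> norm (z / R)" by (rule Schwarz_Lemma(1))
  moreover have "R * (z / R) = z" using R by simp
  ultimately show ?thesis
    using nz[OF zR] R by (simp add: w_def norm_divide field_simps)
qed

text \<open>Once the imaginary part of \<open>h 0\<close> is removed, the Schwarz estimate at ratio
  1/2 bounds \<open>norm (g z) - norm (g 0)\<close> by half of
  \<open>norm (g z) + norm (g 0)\<close>; hence the 3.\<close>

lemma Harnack_at_half_radius:
  assumes h: "h holomorphic_on ball 0 R" and pos: "\<And>z. norm z < R \<Longrightarrow> Re (h z) > 0"
    and z: "norm z \<le> R / 2" and R: "R > 0"
  shows "Re (h z) \<le> 3 * Re (h 0)"
proof -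
  define g where "g z = h z - \<i> * Im (h 0)" for z
  have zR: "norm z < R" using z R by simp
  have g0: "g 0 = of_real (Re (h 0))" by (simp add: g_def complex_eq_iff)
  have "norm (g z - g 0) \<le> norm z / R * norm (g z + cnj (g 0))"
    by (rule schwarz_right_half_plane[OF _ _ zR]) (auto simp: g_def pos intro!: holomorphic_intros h)
  also have "\<dots> \<le> 1 / 2 * (norm (g z) + norm (g 0))"
    using z R norm_triangle_ineq[of "g z" "cnj (g 0)"] by (intro mult_mono) (auto simp: field_simps)
  finally have "norm (g z) - norm (g 0) \<le> 1 / 2 * (norm (g z) + norm (g 0))"
    using norm_triangle_ineq2[of "g z" "g 0"] by linarith
  then have "norm (g z) \<le> 3 * Re (h 0)" using pos[of 0] R by (simp add: g0)
  then show ?thesis using complex_Re_le_cmod[of "g z"] by (simp add: g_def)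
qed

text \<open>The Schwarz estimate for \<open>L - h\<close> at ratio 2/3 gives
  \<open>norm (h z) \<le> 2 / 3 * (2 * L + norm (h z))\<close>, whence the 4.\<close>

lemma Borel_Caratheodory_two_thirds:
  assumes h: "h holomorphic_on ball 0 R" and "h 0 = 0" and less: "\<And>z. norm z < R \<Longrightarrow> Re (h z) < L"
    and z: "norm z \<le> 2 * R / 3" and R: "R > 0"
  shows "norm (h z) \<le> 4 * L"
proof -
  have zR: "norm z < R" using z R by simp
  have L: "L > 0" using less[of 0] assms(2) R by simp
  have "norm ((L - h z) - (L - h 0)) \<le> norm z / R * norm ((L - h z) + cnj (L - h 0))"
    by (rule schwarz_right_half_plane[OF _ _ zR]) (auto simp: less intro!: holomorphic_intros h)
  also have "\<dots> \<le> 2 / 3 * norm ((L - h z) + cnj (L - h 0))"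
    using z R by (intro mult_right_mono) (auto simp: field_simps)
  also have "norm ((L - h z) + cnj (L - h 0)) \<le> norm (complex_of_real (2 * L)) + norm (h z)"
    using norm_triangle_ineq4[of "complex_of_real (2 * L)" "h z"] assms(2) by (simp add: algebra_simps)
  finally show ?thesis using assms(2) L by (simp add: norm_mult)
qed

section \<open>Real parts of polynomials on a circle\<close>

text \<open>On the circle \<open>w * cnj w\<close> is constant, so a mixed monomial reduces to a
  power of \<open>w\<close> or of \<open>cnj w\<close>, and conjugation does not change the real
  part.\<close>

lemma Re_poly_times_cnj_poly:
  fixes p q :: "complex poly"
  shows "\<exists>s. \<forall>w. norm w = R \<longrightarrow> Re (poly p w * cnj (poly q w)) = Re (poly s w)"
proof (induction p q rule: poly_induct2)
  case 0
  then show ?case by (auto intro!: exI[of _ 0])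
next
  case (pCons a p b q)
  then obtain s where s: "\<And>w. norm w = R \<Longrightarrow> Re (poly p w * cnj (poly q w)) = Re (poly s w)" by blast
  define s' where "s' = [:a * cnj b:] + smult (of_real (R\<^sup>2)) s + pCons 0 (smult (cnj a) q)
      + pCons 0 (smult (cnj b) p)"
  have "Re (poly (pCons a p) w * cnj (poly (pCons b q) w)) = Re (poly s' w)" if w: "norm w = R" for w
  proof -
    have "w * cnj w = of_real (R\<^sup>2)"
      using complex_norm_square[of w] w by simp
    then have "poly (pCons a p) w * cnj (poly (pCons b q) w) =
      a * cnj b + of_real (R\<^sup>2) * (poly p w * cnj (poly q w)) + cnj (cnj a * w * poly q w) + cnj b * w * poly p w"
      by (simp add: algebra_simps)
    then have "Re (poly (pCons a p) w * cnj (poly (pCons b q) w)) =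
      Re (a * cnj b) + R\<^sup>2 * Re (poly s w) + Re (cnj (cnj a * w * poly q w)) + Re (cnj b * w * poly p w)"
      using s[OF w] by (simp only: plus_complex.sel scaleR_conv_of_real[symmetric] scaleR_complex.sel)
    then show ?thesis by (simp add: s'_def algebra_simps)
  qed
  then show ?case by blast
qed

text \<open>An approximate solution of the Dirichlet problem, since \<open>Re (poly p w)\<close> is
  harmonic. Stone-Weierstrass applies because
  \<open>2 * Re a * Re b = Re (a * b) + Re (a * cnj b)\<close>, where
  \<open>Re_poly_times_cnj_poly\<close> deals with the second product.\<close>

lemma approx_Re_poly_on_sphere:
  fixes u :: "complex \<Rightarrow> real"
  assumes "continuous_on (sphere 0 R) u" "e > 0"
  obtains p where "\<And>w. norm w = R \<Longrightarrow> \<bar>u w - Re (poly p w)\<bar> < e"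
proof -
  define P where "P v \<longleftrightarrow> (\<exists>p. \<forall>w\<in>sphere 0 R. v w = Re (poly p w))" for v :: "complex \<Rightarrow> real"
  have "\<exists>g. P g \<and> (\<forall>x\<in>sphere 0 R. \<bar>u x - g x\<bar> < e)"
  proof (rule Stone_Weierstrass_HOL)
    show "P (\<lambda>x. c)" for c
      unfolding P_def by (intro exI[of _ "[:of_real c:]"]) auto
    show "continuous_on (sphere 0 R) f" if f: "P f" for f
    proof -
      obtain p where "\<forall>w\<in>sphere 0 R. f w = Re (poly p w)" using f unfolding P_def by blast
      then show ?thesis
        by (subst continuous_on_cong[OF refl, of _ _ "\<lambda>w. Re (poly p w)"]) (auto intro!: continuous_intros)
    qed
    show "P (\<lambda>x. f x + g x)" if fg: "P f \<and> P g" for f g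
    proof -
      obtain p q where "\<forall>w\<in>sphere 0 R. f w = Re (poly p w)" "\<forall>w\<in>sphere 0 R. g w = Re (poly q w)"
        using fg unfolding P_def by blast
      then show ?thesis unfolding P_def by (intro exI[of _ "p + q"]) auto
    qed
    show "P (\<lambda>x. f x * g x)" if fg: "P f \<and> P g" for f g
    proof -
      obtain p q where pq: "\<forall>w\<in>sphere 0 R. f w = Re (poly p w)" "\<forall>w\<in>sphere 0 R. g w = Re (poly q w)"
        using fg unfolding P_def by blast
      obtain s where s: "\<And>w. norm w = R \<Longrightarrow> Re (poly p w * cnj (poly q w)) = Re (poly s w)"
        using Re_poly_times_cnj_poly by blast
      have "f w * g w = Re (poly (smult (1/2) (p * q + s)) w)" if w: "w \<in> sphere 0 R" for w
      proof -
        have "Re (poly p w) * Re (poly q w) = (Re (poly p w * poly q w) + Re (poly p w * cnj (poly q w))) / 2"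
          by simp
        then show ?thesis using pq s[of w] w by simp
      qed
      then show ?thesis unfolding P_def by blast
    qed
    show "\<exists>f. P f \<and> f x \<noteq> f y" if "x \<in> sphere 0 R \<and> y \<in> sphere 0 R \<and> x \<noteq> y" for x y
    proof -
      have "P Re" unfolding P_def by (intro exI[of _ "[:0, 1:]"]) auto
      moreover have "P Im" unfolding P_def by (intro exI[of _ "[:0, -\<i>:]"]) auto
      ultimately show ?thesis using that complex_eq_iff by blast
    qed
  qed (use assms in auto)
  then obtain g p where "\<forall>w\<in>sphere 0 R. \<bar>u w - g w\<bar> < e" "\<forall>w\<in>sphere 0 R. g w = Re (poly p w)"
    unfolding P_def by blast
  then show ?thesis by (intro that[of p]) auto
qed

lemma integral_circle_entire:
  fixes f :: "complex \<Rightarrow> complex"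
  assumes "f holomorphic_on UNIV" and "R > 0"
  shows "((\<lambda>\<theta>. f (of_real R * cis \<theta>)) has_integral (2 * pi * f 0)) {0..2 * pi}"
proof -
  have "((\<lambda>u. f u / (u - 0)) has_contour_integral (2 * of_real pi * \<i> * f 0)) (circlepath 0 R)"
    by (rule Cauchy_integral_circlepath_simple) (use assms holomorphic_on_subset in auto)
  then have "((\<lambda>t. f (R * cis t) / (R * cis t) * R * \<i> * cis t) has_integral (2 * of_real pi * \<i> * f 0)) {0..2*pi}"
    unfolding circlepath_def by (subst (asm) has_contour_integral_part_circlepath_iff) auto
  moreover have "f (R * cis t) / (R * cis t) * R * \<i> * cis t = \<i> * f (R * cis t)" for t
    using assms(2) by (simp add: field_simps cis_neq_zero)
  ultimately have "((\<lambda>t. \<i> * f (R * cis t)) has_integral (2 * of_real pi * \<i> * f 0)) {0..2*pi}"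
    by (simp only:)
  from has_integral_mult_right[OF this, of "-\<i>"] show ?thesis by (simp add: mult_ac)
qed

text \<open>\<open>Re Q\<close> for a suitable polynomial \<open>Q\<close> replaces the Poisson integral of \<open>log_plus |f|\<close>.\<close>

lemma norm_le_exp_proximity:
  assumes f: "f holomorphic_on UNIV" and r: "r > 0" and z: "norm z \<le> r"
  shows "norm (f z) \<le> exp (3 * proximity_function (2 * r) f)"
proof -
  define R where "R = 2 * r"
  have R: "R > 0" using r by (simp add: R_def)
  define u where "u w = log_plus (norm (f w))" for w
  have contu: "continuous_on S u" for S
    unfolding u_def using f holomorphic_on_imp_continuous_on continuous_on_subset
    by (blast intro: continuous_on_log_plus_norm)
  have "norm (f z) \<le> exp (3 * (proximity_function R f + 2 * e))" if e: "e > 0" for e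
  proof -
    \<comment> \<open>The shift by \<open>e\<close> turns two-sided approximation into a strict
      majorant: on the circle \<open>Re (poly p w)\<close> lies between \<open>u w\<close> and
      \<open>u w + 2 * e\<close>.\<close>
    obtain p where p: "\<And>w. norm w = R \<Longrightarrow> \<bar>(u w + e) - Re (poly p w)\<bar> < e"
    proof (rule approx_Re_poly_on_sphere[of R "\<lambda>w. u w + e" e])
      show "continuous_on (sphere 0 R) (\<lambda>w. u w + e)" by (intro continuous_intros contu)
    qed (use e in auto)
    have gt: "u w < Re (poly p w)" and lt: "Re (poly p w) < u w + 2 * e" if "norm w = R" for w
      using p[OF that] by (auto simp: abs_less_iff)
    \<comment> \<open>Minimum principle; Harnack's inequality asks for positivity in the whole
      disc.\<close>
    have pos: "Re (poly p w) > 0" if "norm w < R" for w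
    proof -
      have "compact (sphere (0::complex) R)" "sphere (0::complex) R \<noteq> {}" using R by auto
      then obtain w0 where w0: "norm w0 = R" "\<And>v. norm v = R \<Longrightarrow> Re (poly p w0) \<le> Re (poly p v)"
        using continuous_attains_inf[of "sphere (0::complex) R" "\<lambda>v. Re (poly p v)"]
        by (force intro!: continuous_intros)
      have "Re (- poly p w) \<le> - Re (poly p w0)"
        by (rule maximum_real_frontier[of "\<lambda>w. - poly p w" "cball 0 R"])
          (use w0 R that in \<open>auto intro!: holomorphic_intros continuous_intros\<close>)
      moreover have "u w0 \<ge> 0" by (simp add: u_def log_plus_nonneg)
      ultimately show ?thesis using gt[OF w0(1)] by simp
    qed
    \<comment> \<open>The maximum principle for this entire function stands in for subharmonicity of
      \<open>ln (norm (f w))\<close> and is indifferent to zeros of \<open>f\<close>.\<close>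
    have "norm (f z * exp (- poly p z)) \<le> 1"
    proof (rule maximum_modulus_frontier[of "\<lambda>w. f w * exp (- poly p w)" "cball 0 R"])
      show "(\<lambda>w. f w * exp (- poly p w)) holomorphic_on interior (cball 0 R)"
        by (intro holomorphic_intros holomorphic_on_subset[OF f]) auto
      show "continuous_on (closure (cball 0 R)) (\<lambda>w. f w * exp (- poly p w))"
        by (intro continuous_intros holomorphic_on_imp_continuous_on holomorphic_on_subset[OF f]) auto
      fix w assume "w \<in> frontier (cball (0::complex) R)"
      then have w: "norm w = R" using R by simp
      have "norm (f w) \<le> exp (u w)" unfolding u_def by (rule le_exp_log_plus) simp
      also have "\<dots> \<le> exp (Re (poly p w))" using gt[OF w] by simp
      finally show "norm (f w * exp (- poly p w)) \<le> 1"
        by (simp add: norm_mult norm_divide exp_minus field_simps)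
    qed (use z r in \<open>auto simp: R_def\<close>)
    then have "norm (f z) \<le> exp (Re (poly p z))" by (simp add: norm_mult norm_divide exp_minus field_simps)
    also have "\<dots> \<le> exp (3 * Re (poly p 0))"
      using Harnack_at_half_radius[of "poly p" R z, OF _ pos _ R] z
      by (simp add: R_def holomorphic_intros)
    also have "Re (poly p 0) \<le> proximity_function R f + 2 * e"
    proof -
      have "((\<lambda>\<theta>. Re (poly p (of_real R * cis \<theta>))) has_integral Re (2 * pi * poly p 0)) {0..2 * pi}"
        by (intro has_integral_Re integral_circle_entire R holomorphic_intros)
      moreover have "((\<lambda>\<theta>. u (of_real R * cis \<theta>) + 2 * e) has_integral
          integral {0..2 * pi} (\<lambda>\<theta>. u (of_real R * cis \<theta>)) + (2 * pi - 0) *\<^sub>R (2 * e)) {0..2 * pi}"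
      proof (intro has_integral_add has_integral_const_real[of "2 * e" 0 "2 * pi", simplified content_real] integrable_integral)
        show "(\<lambda>\<theta>. u (of_real R * cis \<theta>)) integrable_on {0..2 * pi}"
          unfolding u_def
          by (intro integrable_continuous_interval continuous_on_log_plus_norm continuous_on_circle f)
        show "((\<lambda>\<theta>. 2 * e) has_integral (2 * pi - 0) *\<^sub>R (2 * e)) {0..2 * pi}"
          using has_integral_const_real[of "2 * e" 0 "2 * pi"] by simp
      qed
      ultimately have "Re (2 * pi * poly p 0) \<le>
          integral {0..2 * pi} (\<lambda>\<theta>. u (of_real R * cis \<theta>)) + (2 * pi - 0) *\<^sub>R (2 * e)"
        by (rule has_integral_le) (use lt R in \<open>auto simp: norm_mult intro: less_imp_le\<close>)
      then show ?thesis by (simp add: proximity_function_def u_def field_simps)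
    qed
    finally show ?thesis by simp
  qed
  note * = this
  have "ln (norm (f z)) / 3 \<le> proximity_function R f + e" if pos: "norm (f z) > 0" and e: "e > 0" for e
  proof -
    have "ln (norm (f z)) \<le> ln (exp (3 * (proximity_function R f + 2 * (e / 2))))"
      using *[of "e / 2"] e pos by (subst ln_le_cancel_iff) auto
    then show ?thesis by simp
  qed
  then have "ln (norm (f z)) / 3 \<le> proximity_function R f" if "norm (f z) > 0"
    using that field_le_epsilon by blast
  then show ?thesis unfolding R_def[symmetric]
    using ln_le_cancel_iff[of "norm (f z)" "exp (3 * proximity_function R f)"]
    by (cases "f z = 0") auto
qed

text \<open>Otherwise the characteristic stays below some \<open>Z\<close> for arbitrarily large
  radii. Each such radius bounds \<open>f\<close> on the disc of half the radius, so
  \<open>f\<close> is bounded, contrary to Liouville's theorem.\<close>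

lemma nevanlinna_T_at_top:
  assumes f: "f holomorphic_on UNIV" and "\<not> f constant_on UNIV"
  shows "filterlim (\<lambda>r. nevanlinna_T r f) at_top at_top"
  unfolding filterlim_at_top
proof
  fix Z :: real
  show "\<forall>\<^sub>F r in at_top. Z \<le> nevanlinna_T r f"
  proof (rule ccontr)
    assume n: "\<not> ?thesis"
    have "norm (f z) \<le> exp (3 * Z)" for z
    proof -
      have "\<exists>r\<ge>max (2 * norm z) 1. nevanlinna_T r f < Z"
        using n unfolding eventually_at_top_linorder by (meson not_le)
      then obtain r where "r \<ge> max (2 * norm z) 1" and r: "nevanlinna_T r f < Z" by blast
      then have "r / 2 > 0" "norm z \<le> r / 2" by auto
      then have "norm (f z) \<le> exp (3 * proximity_function (2 * (r / 2)) f)"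
        by (rule norm_le_exp_proximity[OF f])
      also have "\<dots> \<le> exp (3 * Z)" using r by (simp add: nevanlinna_T_entire[OF f])
      finally show ?thesis .
    qed
    then have "bounded (range f)" by (auto simp: bounded_iff)
    with Liouville_theorem[OF f] assms(2) show False by blast
  qed
qed

lemma proximity_nonneg:
  assumes "f holomorphic_on UNIV"
  shows "0 \<le> proximity_function r f"
  unfolding proximity_function_def
  by (intro mult_nonneg_nonneg integral_nonneg integrable_continuous_interval
      continuous_on_log_plus_norm continuous_on_circle assms log_plus_nonneg) auto

lemma nevanlinna_T_const: "nevanlinna_T r (\<lambda>_. c) = log_plus (norm c)"
  by (simp add: nevanlinna_T_entire proximity_function_def field_simps)

lemma nevanlinna_T_le:
  assumes "f holomorphic_on UNIV" "B \<ge> 0" "r \<ge> 0" "\<And>z. norm z \<le> r \<Longrightarrow> norm (f z) \<le> exp B"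
  shows "nevanlinna_T r f \<le> B"
  unfolding nevanlinna_T_entire[OF assms(1)]
  by (rule proximity_function_le) (use assms in auto)

lemma norm_le_exp_nevanlinna_T:
  assumes "f holomorphic_on UNIV" "r > 0" "norm z \<le> r"
  shows "norm (f z) \<le> exp (3 * nevanlinna_T (2 * r) f)"
  unfolding nevanlinna_T_entire[OF assms(1)] by (rule norm_le_exp_proximity) (use assms in auto)

lemma nevanlinna_T_nonneg: "f holomorphic_on UNIV \<Longrightarrow> 0 \<le> nevanlinna_T r f"
  by (simp add: nevanlinna_T_entire proximity_nonneg)

section \<open>Logarithmic derivatives away from the zeros\<close>

lemma norm_one_minus_ge:
  fixes z a :: complex
  assumes "a \<noteq> 0" "norm a \<le> \<rho>" "norm z = 3 * \<rho>"
  shows "norm (1 - z / a) \<ge> 2"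
proof -
  have "3 * norm a \<le> norm z" using assms by simp
  then have "norm (z / a) \<ge> 3" using assms(1) by (simp add: norm_divide field_simps)
  then show ?thesis using norm_triangle_ineq3[of 1 "z / a"] by simp
qed

text \<open>The singularity of the quotient is removable. The factor \<open>1 - z / a\<close>,
  rather than \<open>z - a\<close>, keeps the value at 0 unchanged.\<close>

lemma divide_by_zero_factor:
  fixes G :: "complex \<Rightarrow> complex"
  assumes G: "G holomorphic_on UNIV" and a: "G a = 0" "a \<noteq> 0"
  obtains H where "H holomorphic_on UNIV" "\<And>z. G z = (1 - z / a) * H z"
proof -
  define F where "F z = (if z = a then deriv G a else G z / (z - a))" for z
  have "F holomorphic_on UNIV"
    by (rule pole_theorem_open_0[OF G, where a = a]) (auto simp: F_def a)
  then have "(\<lambda>z. - a * F z) holomorphic_on UNIV" by (intro holomorphic_intros)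
  moreover have "G z = (1 - z / a) * (- a * F z)" for z
    using a by (auto simp: F_def field_simps)
  ultimately show ?thesis using that by blast
qed

text \<open>Each factor has modulus at least 2 on the circle of radius \<open>3 * \<rho>\<close>, so a factorization with
  the greatest number of factors exists and its cofactor has no zeros left in the disc.\<close>

lemma zero_factorization:
  fixes L \<rho> :: real
  assumes g: "g holomorphic_on UNIV" "g 0 = 1" and \<rho>: "\<rho> > 0"
    and bound: "\<And>z. norm z \<le> 3 * \<rho> \<Longrightarrow> norm (g z) \<le> exp L"
  obtains as G where "G holomorphic_on UNIV" "G 0 = 1" "\<And>z. g z = (\<Prod>a\<leftarrow>as. 1 - z / a) * G z"
    "\<And>a. a \<in> set as \<Longrightarrow> a \<noteq> 0" "length as \<le> 2 * L"
    "\<And>z. norm z \<le> \<rho> \<Longrightarrow> G z \<noteq> 0" "\<And>z. norm z \<le> 3 * \<rho> \<Longrightarrow> norm (G z) \<le> exp L"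
proof -
  define P where "P n as G \<longleftrightarrow> length as = n \<and> G holomorphic_on UNIV \<and> G 0 = 1 \<and>
    (\<forall>z. g z = (\<Prod>a\<leftarrow>as. 1 - z / a) * G z) \<and> (\<forall>a\<in>set as. a \<noteq> 0 \<and> norm a \<le> \<rho>)" for n as G
  have le: "norm (G z) \<le> exp L / 2 ^ n" if P: "P n as G" and z: "norm z \<le> 3 * \<rho>" for n as G z
  proof (rule maximum_modulus_frontier[of G "cball 0 (3 * \<rho>)"])
    have hol: "G holomorphic_on S" for S using P holomorphic_on_subset unfolding P_def by blast
    show "G holomorphic_on interior (cball 0 (3 * \<rho>))" by (rule hol)
    show "continuous_on (closure (cball 0 (3 * \<rho>))) G" by (rule holomorphic_on_imp_continuous_on[OF hol])
    fix w assume "w \<in> frontier (cball (0::complex) (3 * \<rho>))"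
    then have w: "norm w = 3 * \<rho>" using \<rho> by simp
    have "2 ^ length as \<le> norm (\<Prod>a\<leftarrow>as. 1 - w / a)" if "\<forall>a\<in>set as. a \<noteq> 0 \<and> norm a \<le> \<rho>" for as
      using that
    proof (induction as)
      case (Cons a as)
      then show ?case using mult_mono[OF norm_one_minus_ge[OF _ _ w, of a] Cons.IH]
        by (simp add: norm_mult)
    qed simp
    then have "2 ^ n * norm (G w) \<le> norm (g w)"
      using P unfolding P_def by (auto simp: norm_mult intro!: mult_right_mono)
    also have "\<dots> \<le> exp L" using bound w by simp
    finally show "norm (G w) \<le> exp L / 2 ^ n" by (simp add: field_simps)
  qed (use z in auto)
  \<comment> \<open>At the origin \<open>G 0 = 1\<close>, so \<open>2 ^ n \<le> exp L\<close>. This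
    bounds the number of zeros in place of Jensen's formula.\<close>
  have n_le: "n \<le> 2 * L" if P: "P n as G" for n as G
  proof -
    have "G 0 = 1" using P by (simp add: P_def)
    then have "2 ^ n \<le> exp L" using le[OF P, of 0] \<rho> by (simp add: field_simps)
    then have "ln (2 ^ n) \<le> L" by (subst ln_le_cancel_iff[of _ "exp L", simplified]) auto
    then have "n * ln 2 \<le> L" by (simp add: ln_realpow)
    moreover have "n * (1 / 2) \<le> n * ln (2::real)"
      using ln2_ge_two_thirds by (intro mult_left_mono) auto
    ultimately show ?thesis by linarith
  qed
  define n where "n = (GREATEST n. \<exists>as G. P n as G)"
  have ex: "\<exists>as G. P 0 as G" using g by (intro exI[of _ "[]"] exI[of _ g]) (simp add: P_def)
  have ub: "m \<le> nat \<lfloor>2 * L\<rfloor>" if "\<exists>as G. P m as G" for m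
    using n_le that by (force simp: le_nat_floor)
  obtain as G where P: "P n as G"
    using GreatestI_nat[of "\<lambda>n. \<exists>as G. P n as G", OF ex ub] unfolding n_def by blast
  show ?thesis
  proof
    show "G holomorphic_on UNIV" "G 0 = 1" "\<And>z. g z = (\<Prod>a\<leftarrow>as. 1 - z / a) * G z"
      "\<And>a. a \<in> set as \<Longrightarrow> a \<noteq> 0" "length as \<le> 2 * L"
      using P n_le[OF P] unfolding P_def by auto
    show "norm (G z) \<le> exp L" if "norm z \<le> 3 * \<rho>" for z
    proof -
      have "norm (G z) \<le> exp L / 2 ^ n" by (rule le[OF P that])
      also have "\<dots> \<le> exp L / 1" by (intro divide_left_mono) auto
      finally show ?thesis by simp
    qed
    show "G z \<noteq> 0" if z: "norm z \<le> \<rho>" for z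
    proof
      assume Gz: "G z = 0"
      have z0: "z \<noteq> 0" using Gz P unfolding P_def by auto
      obtain H where H: "H holomorphic_on UNIV" "\<And>w. G w = (1 - w / z) * H w"
        using divide_by_zero_factor[of G z, OF _ Gz z0] P unfolding P_def by blast
      have "H 0 = 1" using H(2)[of 0] P unfolding P_def by simp
      then have "P (Suc n) (z # as) H"
        using H P z z0 unfolding P_def by (auto simp: mult_ac)
      then have "Suc n \<le> n"
        unfolding n_def by (intro Greatest_le_nat[of "\<lambda>n. \<exists>as G. P n as G", OF _ ub]) blast+
      then show False by simp
    qed
  qed
qed

text \<open>Moving from \<open>z0\<close> to \<open>z\<close> increases the distance to a zero by at
  most \<open>\<eta>\<close>, hence by a factor of at most
  \<open>1 + \<eta> / \<delta> \<le> exp (\<eta> / \<delta>)\<close>.\<close>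

lemma prod_list_ratio_bound:
  fixes z z0 :: complex
  assumes "\<And>a. a \<in> set as \<Longrightarrow> a \<noteq> 0 \<and> \<delta> \<le> norm (z0 - a)" and "\<delta> > 0" and "norm (z - z0) \<le> \<eta>"
  shows "norm (\<Prod>a\<leftarrow>as. 1 - z / a) \<le> exp (length as * (\<eta> / \<delta>)) * norm (\<Prod>a\<leftarrow>as. 1 - z0 / a)"
  using assms(1)
proof (induction as)
  case (Cons a as)
  have a: "a \<noteq> 0" "\<delta> \<le> norm (z0 - a)" using Cons.prems by auto
  have eta: "\<eta> \<ge> 0" using assms(3) norm_ge_zero order_trans by blast
  have "norm (z - a) \<le> \<eta> + norm (z0 - a)"
    using norm_triangle_ineq[of "z - z0" "z0 - a"] assms(3) by simp
  also have "\<dots> \<le> (1 + \<eta> / \<delta>) * norm (z0 - a)"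
    using mult_left_mono[OF a(2), of "\<eta> / \<delta>"] eta assms(2) by (simp add: distrib_right)
  also have "\<dots> \<le> exp (\<eta> / \<delta>) * norm (z0 - a)"
    by (intro mult_right_mono exp_ge_add_one_self) auto
  finally have "norm (z - a) / norm a \<le> exp (\<eta> / \<delta>) * norm (z0 - a) / norm a"
    by (rule divide_right_mono) simp
  moreover have "norm (1 - w / a) = norm (w - a) / norm a" for w
    using a by (simp add: diff_divide_eq_iff norm_divide norm_minus_commute flip: norm_divide)
  ultimately have "norm (1 - z / a) \<le> exp (\<eta> / \<delta>) * norm (1 - z0 / a)" by simp
  from mult_mono[OF this Cons.IH] Cons.prems
  have "norm (1 - z / a) * norm (\<Prod>a\<leftarrow>as. 1 - z / a) \<le>
      exp (\<eta> / \<delta>) * norm (1 - z0 / a) * (exp (length as * (\<eta> / \<delta>)) * norm (\<Prod>a\<leftarrow>as. 1 - z0 / a))"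
    by simp
  moreover have "exp (length (a # as) * (\<eta> / \<delta>)) = exp (\<eta> / \<delta>) * exp (length as * (\<eta> / \<delta>))"
    by (simp add: distrib_right add_divide_distrib flip: exp_add)
  ultimately show ?case by (simp only: norm_mult list.map prod_list.Cons mult_ac)
qed simp

text \<open>On a disc of radius \<open>\<delta> / (32 * L)\<close> about \<open>z0\<close> the
  function stays below \<open>9 * norm (g z0)\<close>, and Cauchy's inequality there handles all
  derivatives at once. The list \<open>as\<close> is fixed before \<open>z0\<close> and
  \<open>\<delta>\<close>, so that one circle can later avoid the zeros of several
  functions.\<close>

lemma higher_log_derivative_bound:
  fixes L r :: real
  assumes g: "g holomorphic_on UNIV" "g 0 = 1" and r: "r \<ge> 1" and L: "L \<ge> 1"
    and bound: "\<And>z. norm z \<le> 9 * r \<Longrightarrow> norm (g z) \<le> exp L"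
  obtains as where "length as \<le> 2 * L"
    "\<And>z0 \<delta> m. norm z0 \<le> 3 / 2 * r \<Longrightarrow> 0 < \<delta> \<Longrightarrow> \<delta> \<le> 1 \<Longrightarrow> (\<And>a. a \<in> set as \<Longrightarrow> \<delta> \<le> norm (z0 - a)) \<Longrightarrow>
      g z0 \<noteq> 0 \<and> norm ((deriv ^^ m) g z0) \<le> fact m * 9 * (32 * L / \<delta>) ^ m * norm (g z0)"
proof -
  obtain as G where G: "G holomorphic_on UNIV" "G 0 = 1" and gG: "\<And>z. g z = (\<Prod>a\<leftarrow>as. 1 - z / a) * G z"
    and as: "\<And>a. a \<in> set as \<Longrightarrow> a \<noteq> 0" "length as \<le> 2 * L"
    and nz: "\<And>z. norm z \<le> 3 * r \<Longrightarrow> G z \<noteq> 0" and GL: "\<And>z. norm z \<le> 3 * (3 * r) \<Longrightarrow> norm (G z) \<le> exp L"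
    by (rule zero_factorization[of g "3 * r" L]) (use g r bound in auto)
  have "G holomorphic_on ball 0 (3 * r)" using G(1) holomorphic_on_subset by blast
  then obtain h0 where h0: "h0 holomorphic_on ball 0 (3 * r)" "\<And>x. x \<in> ball 0 (3 * r) \<Longrightarrow> exp (h0 x) = G x"
    using holomorphic_logarithm_exists[of "ball 0 (3 * r)" G 0] nz r by (auto simp: less_imp_le)
  define h where "h z = h0 z - h0 0" for z
  have h: "h holomorphic_on ball 0 (3 * r)" "h 0 = 0"
    unfolding h_def by (auto intro!: holomorphic_intros h0)
  have eh: "exp (h z) = G z" if "norm z < 3 * r" for z
    using h0(2)[of z] h0(2)[of 0] that r G(2) by (simp add: h_def exp_diff)
  \<comment> \<open>The bound \<open>L\<close> is doubled to make the inequality strict, as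
    \<open>Borel_Caratheodory_two_thirds\<close> asks.\<close>
  have "Re (h z) < 2 * L" if z: "norm z < 3 * r" for z
  proof -
    have "exp (Re (h z)) \<le> exp L" using GL[of z] z r eh[OF z, symmetric] by simp
    then show ?thesis using L by simp
  qed
  then have h_le: "norm (h z) \<le> 8 * L" if "norm z \<le> 2 * r" for z
    using Borel_Caratheodory_two_thirds[OF h, of "2 * L" z] that r by simp
  \<comment> \<open>Since \<open>r \<ge> 1\<close>, discs of radius 1/4 about these points stay
    within radius \<open>2 * r\<close>, where \<open>8 * L\<close> is available.\<close>
  have dh: "norm (deriv h z) \<le> 32 * L" if z: "norm z \<le> 7 / 4 * r" for z
  proof -
    have sub: "norm w \<le> 2 * r" if "norm (z - w) \<le> 1 / 4" for w
      using norm_triangle_ineq[of z "w - z"] that z r by (simp add: norm_minus_commute)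
    then have "cball z (1 / 4) \<subseteq> ball 0 (3 * r)" using r by (auto simp: dist_norm) (smt (verit))
    then have "h holomorphic_on cball z (1/4)" using h(1) holomorphic_on_subset by blast
    then have "norm ((deriv ^^ 1) h z) \<le> fact 1 * (8 * L) / (1 / 4) ^ 1"
      by (intro Cauchy_inequality) (use h_le sub in \<open>auto intro: holomorphic_on_imp_continuous_on holomorphic_on_subset\<close>)
    then show ?thesis by simp
  qed
  have main: "g z0 \<noteq> 0 \<and> norm ((deriv ^^ m) g z0) \<le> fact m * 9 * (32 * L / \<delta>) ^ m * norm (g z0)"
    if z0: "norm z0 \<le> 3 / 2 * r" and \<delta>: "0 < \<delta>" "\<delta> \<le> 1" and far: "\<And>a. a \<in> set as \<Longrightarrow> \<delta> \<le> norm (z0 - a)"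
    for z0 \<delta> m
  proof -
    \<comment> \<open>A move by \<open>\<eta>\<close> changes \<open>h\<close> by at most 1 and
      multiplies the product of at most \<open>2 * L\<close> factors by at most
      \<open>exp 1\<close>. The two resulting factors \<open>exp 1 \<le> 3\<close> give the
      9.\<close>
    define \<eta> where "\<eta> = \<delta> / (32 * L)"
    have eta: "0 < \<eta>" "\<eta> \<le> 1 / 4" "32 * L * \<eta> \<le> 1" "2 * L * (\<eta> / \<delta>) \<le> 1"
      using \<delta> L by (auto simp: \<eta>_def field_simps)
    have "(\<Prod>a\<leftarrow>as. 1 - z0 / a) \<noteq> 0"
      unfolding prod_list_zero_iff using far as(1) \<delta>(1) by (force simp: field_simps)
    then have nz0: "g z0 \<noteq> 0" using gG nz[of z0] z0 r by auto
    have "norm (g z) \<le> 9 * norm (g z0)" if z: "norm (z - z0) \<le> \<eta>" for z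
    proof -
      have nzz: "norm w \<le> 7 / 4 * r" if "w \<in> cball z0 \<eta>" for w
        using norm_triangle_ineq[of z0 "w - z0"] that z0 eta r by (simp add: dist_norm norm_minus_commute)
      have "norm (h z - h z0) \<le> 32 * L * norm (z - z0)"
      proof (rule field_differentiable_bound[of "cball z0 \<eta>" h "deriv h"])
        show "(h has_field_derivative deriv h w) (at w within cball z0 \<eta>)" if "w \<in> cball z0 \<eta>" for w
          using holomorphic_derivI[OF h(1), of w] nzz[OF that] r by auto
        show "norm (deriv h w) \<le> 32 * L" if "w \<in> cball z0 \<eta>" for w using dh nzz[OF that] .
      qed (use z eta in \<open>auto simp: dist_norm norm_minus_commute\<close>)
      also have "\<dots> \<le> 32 * L * \<eta>" using z L by (intro mult_left_mono) auto
      also have "\<dots> \<le> 1" by (rule eta)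
      finally have "Re (h z) \<le> 1 + Re (h z0)"
        using complex_Re_le_cmod[of "h z - h z0"] by simp
      moreover have "G z = exp (h z)" "G z0 = exp (h z0)"
        using eh[of z] eh[of z0] nzz[of z] nzz[of z0] z eta r
        by (auto simp: dist_norm norm_minus_commute)
      ultimately have "norm (G z) \<le> exp 1 * norm (G z0)"
        by (simp flip: exp_add)
      moreover have "norm (\<Prod>a\<leftarrow>as. 1 - z / a) \<le> exp 1 * norm (\<Prod>a\<leftarrow>as. 1 - z0 / a)"
      proof -
        have "norm (\<Prod>a\<leftarrow>as. 1 - z / a) \<le> exp (length as * (\<eta> / \<delta>)) * norm (\<Prod>a\<leftarrow>as. 1 - z0 / a)"
          by (rule prod_list_ratio_bound) (use as far \<delta> z in auto)
        also have "length as * (\<eta> / \<delta>) \<le> 2 * L * (\<eta> / \<delta>)"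
          using as(2) eta \<delta> by (intro mult_right_mono) auto
        also note eta(4)
        finally show ?thesis by (simp add: mult_right_mono)
      qed
      ultimately have "norm (g z) \<le> (exp 1 * norm (\<Prod>a\<leftarrow>as. 1 - z0 / a)) * (exp 1 * norm (G z0))"
        unfolding gG norm_mult by (intro mult_mono) auto
      also have "\<dots> = (exp 1 * exp 1) * norm (g z0)" by (simp add: gG norm_mult)
      also have "\<dots> \<le> (3 * 3) * norm (g z0)"
        by (intro mult_right_mono mult_mono) (use exp_le in auto)
      finally show ?thesis by simp
    qed
    then have "norm ((deriv ^^ m) g z0) \<le> fact m * (9 * norm (g z0)) / \<eta> ^ m"
      by (intro Cauchy_inequality)
        (use eta g(1) in \<open>auto simp: norm_minus_commute intro!: holomorphic_on_imp_continuous_on intro: holomorphic_on_subset\<close>)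
    also have "\<dots> = fact m * 9 * (32 * L / \<delta>) ^ m * norm (g z0)"
      by (simp add: \<eta>_def power_divide field_simps)
    finally show ?thesis using nz0 by simp
  qed
  show ?thesis by (rule that[OF as(2)]) (use main in auto)
qed

text \<open>Pigeonhole: among \<open>card S + 1\<close> equally spaced radii, a point of
  \<open>S\<close> can be closer than half the spacing to one only.\<close>

lemma circle_avoiding_finite_set:
  fixes S :: "real set"
  assumes "finite S" "r \<ge> 1"
  obtains s where "r \<le> s" "s \<le> 3 / 2 * r" "\<And>a. a \<in> S \<Longrightarrow> 1 / (4 * (card S + 1)) \<le> \<bar>s - a\<bar>"
proof -
  define d where "d = r / (2 * (card S + 1))"
  define s where "s j = r + j * d" for j :: nat
  have d: "d > 0" using assms(2) by (simp add: d_def)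
  have s_diff: "s i - s j = (real i - real j) * d" for i j by (simp add: s_def algebra_simps)
  have "\<exists>j\<le>card S. \<forall>a\<in>S. d / 2 \<le> \<bar>s j - a\<bar>"
  proof (rule ccontr)
    assume "\<not> ?thesis"
    then have "\<forall>j\<in>{..card S}. \<exists>a. a \<in> S \<and> \<bar>s j - a\<bar> < d / 2" by (meson atMost_iff not_le)
    from bchoice[OF this] obtain f where
      f: "\<And>j. j \<le> card S \<Longrightarrow> f j \<in> S" "\<And>j. j \<le> card S \<Longrightarrow> \<bar>s j - f j\<bar> < d / 2"
      by auto
    have "inj_on f {..card S}"
    proof (rule inj_onI)
      fix i j assume ij: "i \<in> {..card S}" "j \<in> {..card S}" "f i = f j"
      then have "\<bar>s i - f i\<bar> < d / 2" "\<bar>s j - f i\<bar> < d / 2" using f(2)[of i] f(2)[of j] by auto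
      then have "\<bar>s i - s j\<bar> < d" by linarith
      then have "\<bar>real i - real j\<bar> < 1" using d by (simp add: s_diff abs_mult)
      then show "i = j" by linarith
    qed
    from card_inj_on_le[OF this _ assms(1)] f(1) show False by auto
  qed
  then obtain j where j: "j \<le> card S" "\<And>a. a \<in> S \<Longrightarrow> d / 2 \<le> \<bar>s j - a\<bar>" by blast
  have "1 / (4 * (card S + 1)) \<le> d / 2" using assms(2) by (simp add: d_def field_simps)
  moreover have "s j \<le> 3 / 2 * r"
  proof -
    have "j * d \<le> (card S + 1) * d" using j(1) d by (intro mult_right_mono) auto
    also have "\<dots> = r / 2" by (simp add: d_def field_simps)
    finally show ?thesis by (simp add: s_def)
  qed
  moreover have "r \<le> s j" using d by (simp add: s_def)
  ultimately show ?thesis using that j(2) order_trans by metis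
qed

section \<open>Bounding the coefficients by the solutions\<close>

text \<open>Each step costs 1 in the radius, for Cauchy's inequality on a unit circle, and a factor
  4 in the exponent, since two products of size \<open>exp (2 * M)\<close> add up to at most
  \<open>exp (4 * M)\<close>.\<close>

lemma norm_iterated_order_red_le:
  fixes r L :: real
  assumes hol: "\<And>i. f i holomorphic_on UNIV" and L: "L \<ge> 1"
    and "\<And>i z. norm z \<le> r \<Longrightarrow> norm (f i z) \<le> exp L"
    and "norm z \<le> r - n"
  shows "norm ((order_red ^^ n) f i z) \<le> exp (4 ^ n * L)"
  using assms(4)
proof (induction n arbitrary: i z)
  case 0
  then show ?case using assms(3) by simp
next
  case (Suc n)
  define g where "g = (order_red ^^ n) f"
  define M where "M = 4 ^ n * L"
  have M: "M \<ge> 1" using mult_mono[of 1 "4 ^ n" 1 L] L by (simp add: M_def)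
  have hg: "g j holomorphic_on UNIV" for j unfolding g_def by (rule holomorphic_iterated_order_red[OF hol])
  have g_le: "norm (g j w) \<le> exp M" if "norm w \<le> r - n" for j w
    using Suc.IH[OF that] by (simp add: g_def M_def)
  have dg: "norm (deriv (g j) z) \<le> exp M" for j
  proof -
    have "norm ((deriv ^^ 1) (g j) z) \<le> fact 1 * exp M / 1 ^ 1"
    proof (rule Cauchy_inequality)
      show "norm (g j w) \<le> exp M" if "norm (z - w) = 1" for w
        using g_le[of w j] norm_triangle_ineq[of z "w - z"] Suc.prems that by (simp add: norm_minus_commute)
    qed (auto intro: holomorphic_on_subset[OF hg] holomorphic_on_imp_continuous_on)
    then show ?thesis by simp
  qed
  have gz: "norm (g j z) \<le> exp M" for j using g_le[of z j] Suc.prems by simp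
  have "norm (order_red g i z) \<le> exp M * exp M + exp M * exp M"
    unfolding order_red_def
    by (rule norm_triangle_le_diff, unfold norm_mult, intro add_mono mult_mono dg gz) auto
  also have "\<dots> = 2 * exp (2 * M)" by (simp flip: exp_add)
  also have "\<dots> \<le> exp 1 * exp (2 * M)" using exp_ge_add_one_self[of 1] by simp
  also have "\<dots> \<le> exp (4 * M)" using M by (simp flip: exp_add)
  finally show ?case by (simp add: g_def M_def mult_ac)
qed

lemma coefficient_bound_explicit:
  fixes r L :: real
  assumes k: "k > 0" and A: "\<And>j. j < k \<Longrightarrow> A j holomorphic_on UNIV"
    and f: "\<And>i. f i holomorphic_on UNIV" and Lf: "\<And>i z. i < k \<Longrightarrow> lin_diff_op k A (f i) z = 0"
    and init: "\<And>i m. i < k \<Longrightarrow> m < k \<Longrightarrow> (deriv ^^ m) (f i) 0 = (if m = i then 1 else 0)"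
    and r: "r \<ge> k" and L: "L \<ge> 1"
    and bound: "\<And>i z. norm z \<le> 10 * r \<Longrightarrow> norm (f i z) \<le> exp L"
    and j: "j < k" and z: "norm z \<le> r"
  shows "norm (A j z) \<le> (real k * 2 ^ k * (fact k * 9 * (384 * real k * (4 ^ k * L)\<^sup>2) ^ k)) ^ k"
proof -
  define M where "M = 4 ^ k * L"
  have M: "M \<ge> 1" using mult_mono[of 1 "4 ^ k" 1 L] L by (simp add: M_def)
  have r1: "r \<ge> 1" using r k by simp
  define h where "h n = (order_red ^^ n) f 0" for n
  have hol: "h n holomorphic_on UNIV" for n
    unfolding h_def by (rule holomorphic_iterated_order_red[OF f])
  have h0: "h n 0 = 1" if "n < k" for n
    unfolding h_def by (rule order_red_head_at_0[where g = f and k = k, OF f init that])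
  have hM: "norm (h n z) \<le> exp M" if "n < k" "norm z \<le> 9 * r" for n z
  proof -
    have "norm z \<le> 10 * r - n" using that r by simp
    from norm_iterated_order_red_le[where i = 0, OF f L bound this] have "norm (h n z) \<le> exp (4 ^ n * L)"
      by (simp add: h_def)
    also have "\<dots> \<le> exp M"
      using that L by (simp add: M_def mult_right_mono power_increasing)
    finally show ?thesis .
  qed
  have "\<exists>as. length as \<le> 2 * M \<and> (\<forall>z0 \<delta> m. norm z0 \<le> 3 / 2 * r \<longrightarrow> 0 < \<delta> \<longrightarrow> \<delta> \<le> 1 \<longrightarrow>
       (\<forall>a \<in> set as. \<delta> \<le> norm (z0 - a)) \<longrightarrow>
       h n z0 \<noteq> 0 \<and> norm ((deriv ^^ m) (h n) z0) \<le> fact m * 9 * (32 * M / \<delta>) ^ m * norm (h n z0))"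
    if n: "n < k" for n
  proof (rule higher_log_derivative_bound[OF hol h0[OF n] r1 M hM[OF n]], assumption)
    fix as
    assume "real (length as) \<le> 2 * M"
      "\<And>z0 \<delta> m. norm z0 \<le> 3 / 2 * r \<Longrightarrow> 0 < \<delta> \<Longrightarrow> \<delta> \<le> 1 \<Longrightarrow> (\<And>a. a \<in> set as \<Longrightarrow> \<delta> \<le> norm (z0 - a)) \<Longrightarrow>
        h n z0 \<noteq> 0 \<and> norm ((deriv ^^ m) (h n) z0) \<le> fact m * 9 * (32 * M / \<delta>) ^ m * norm (h n z0)"
    then show ?thesis by (intro exI[of _ as]) auto
  qed
  then obtain as where as: "\<And>n. n < k \<Longrightarrow> length (as n) \<le> 2 * M"
    and log_deriv: "\<And>n z0 \<delta> m. n < k \<Longrightarrow> norm z0 \<le> 3 / 2 * r \<Longrightarrow> 0 < \<delta> \<Longrightarrow> \<delta> \<le> 1 \<Longrightarrow>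
       (\<And>a. a \<in> set (as n) \<Longrightarrow> \<delta> \<le> norm (z0 - a)) \<Longrightarrow>
       h n z0 \<noteq> 0 \<and> norm ((deriv ^^ m) (h n) z0) \<le> fact m * 9 * (32 * M / \<delta>) ^ m * norm (h n z0)"
    by metis
  \<comment> \<open>Only moduli matter: a point on the circle of radius \<open>s\<close> about 0 has
    distance at least \<open>\<bar>s - norm a\<bar>\<close> from \<open>a\<close>.\<close>
  define S where "S = (\<Union>n<k. norm ` set (as n))"
  have finS: "finite S" by (simp add: S_def)
  have "card S \<le> (\<Sum>n<k. card (norm ` set (as n)))"
    unfolding S_def by (rule card_UN_le) simp
  also have "\<dots> \<le> (\<Sum>n<k. length (as n))"
    by (intro sum_mono order_trans[OF card_image_le card_length]) simp
  finally have "real (card S) \<le> (\<Sum>n<k. real (length (as n)))"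
    by (metis of_nat_le_iff of_nat_sum)
  also have "\<dots> \<le> (\<Sum>n<k. 2 * M)" by (intro sum_mono as) auto
  finally have cardS: "card S \<le> 2 * k * M" by simp
  \<comment> \<open>From \<open>card S \<le> 2 * k * M\<close> and \<open>k * M \<ge> 1\<close>
    follows \<open>4 * (card S + 1) \<le> 12 * k * M\<close>. This is also the origin of 384 = 32 *
    12.\<close>
  define \<delta> where "\<delta> = 1 / (12 * k * M)"
  have kM: "k * M \<ge> 1" using mult_mono[of 1 "real k" 1 M] M k by simp
  have \<delta>: "0 < \<delta>" "\<delta> \<le> 1" using kM k M by (auto simp: \<delta>_def field_simps)
  have \<delta>_le: "\<delta> \<le> 1 / (4 * (card S + 1))"
    unfolding \<delta>_def using cardS kM k M by (intro divide_left_mono) (auto intro!: mult_pos_pos)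
  obtain s where s: "r \<le> s" "s \<le> 3 / 2 * r" "\<And>a. a \<in> S \<Longrightarrow> 1 / (4 * (card S + 1)) \<le> \<bar>s - a\<bar>"
    using circle_avoiding_finite_set[OF finS r1] by blast
  define B where "B = fact k * 9 * (384 * k * M\<^sup>2) ^ k"
  have M2: "384 * k * M\<^sup>2 \<ge> 1"
    using mult_mono[OF kM M] M by (simp add: power2_eq_square mult_ac)
  have B1: "B \<ge> 1"
  proof -
    have "1 * 9 * 1 \<le> B" unfolding B_def
      by (intro mult_mono one_le_power M2 fact_ge_1) (use M2 in auto)
    then show ?thesis by simp
  qed
  have on_circle: "norm (A j w) \<le> (real k * 2 ^ k * B) ^ k" if w: "norm w = s" for w
  proof -
    have far: "\<delta> \<le> norm (w - a)" if "n < k" "a \<in> set (as n)" for n a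
    proof -
      have "norm a \<in> S" using that by (auto simp: S_def)
      then have "\<delta> \<le> \<bar>s - norm a\<bar>" using s(3) \<delta>_le order_trans by blast
      then show ?thesis using norm_triangle_ineq3[of w a] w by simp
    qed
    define a where "a m = (if m = k then 1 else A m w)" for m
    have "norm (a j) \<le> (real k * 2 ^ k * B) ^ k"
    proof (rule coefficient_bound[where g = f and z = w])
      show "(\<Sum>m\<le>k. a m * (deriv ^^ m) (f i) w) = 0" if "i < k" for i
      proof -
        have "(\<Sum>m\<le>k. a m * (deriv ^^ m) (f i) w) = lin_diff_op k A (f i) w"
          unfolding lin_diff_op_def lessThan_Suc_atMost[symmetric] sum.lessThan_Suc
          by (simp add: a_def add.commute)
        then show ?thesis using Lf[OF that] by simp
      qed
      show "(order_red ^^ n) f 0 w \<noteq> 0" if "n < k" for n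
        using log_deriv[OF that _ \<delta> far] that w s by (simp add: h_def)
      show "norm ((deriv ^^ m) ((order_red ^^ n) f 0) w) \<le> B * norm ((order_red ^^ n) f 0 w)"
        if "n < k" "m \<le> k" for n m
      proof -
        have "norm ((deriv ^^ m) (h n) w) \<le> fact m * 9 * (32 * M / \<delta>) ^ m * norm (h n w)"
          using log_deriv[where m = m, OF that(1) _ \<delta> far] that w s by simp
        also have "32 * M / \<delta> = 384 * k * M\<^sup>2" using k M by (simp add: \<delta>_def power2_eq_square)
        also have "fact m * 9 * (384 * k * M\<^sup>2) ^ m * norm (h n w) \<le> B * norm (h n w)"
          unfolding B_def using that M2
          by (intro mult_right_mono mult_mono fact_mono power_increasing) auto
        finally show ?thesis by (simp add: h_def)
      qed
    qed (use B1 f j in \<open>auto simp: a_def\<close>)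
    then show ?thesis using j by (simp add: a_def)
  qed
  have "norm (A j z) \<le> (real k * 2 ^ k * B) ^ k"
  proof (rule maximum_modulus_frontier[of "A j" "cball 0 s"])
    have hA: "A j holomorphic_on X" for X using A[OF j] holomorphic_on_subset by blast
    show "A j holomorphic_on interior (cball 0 s)" by (rule hA)
    show "continuous_on (closure (cball 0 s)) (A j)" by (rule holomorphic_on_imp_continuous_on[OF hA])
  qed (use on_circle s z r1 in auto)
  then show ?thesis by (simp add: B_def M_def)
qed

text \<open>The constants depend on \<open>k\<close> alone and can be fixed before \<open>r\<close>
  tends to infinity. The exponent \<open>2 * k * k\<close> comes from
  \<open>((L\<^sup>2) ^ k) ^ k\<close>.\<close>

lemma ln_coefficient_bound:
  assumes "k > 0"
  obtains c p :: real where "c \<ge> 0" "p \<ge> 0" "\<And>A f (r::real) L j z.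
    (\<And>j. j < k \<Longrightarrow> A j holomorphic_on UNIV) \<Longrightarrow>
    (\<And>i. f i holomorphic_on UNIV) \<Longrightarrow> (\<And>i z. i < k \<Longrightarrow> lin_diff_op k A (f i) z = 0) \<Longrightarrow>
    (\<And>i m. i < k \<Longrightarrow> m < k \<Longrightarrow> (deriv ^^ m) (f i) 0 = (if m = i then 1 else 0)) \<Longrightarrow>
    r \<ge> k \<Longrightarrow> L \<ge> 1 \<Longrightarrow> (\<And>i z. norm z \<le> 10 * r \<Longrightarrow> norm (f i z) \<le> exp L) \<Longrightarrow>
    j < k \<Longrightarrow> norm z \<le> r \<Longrightarrow> norm (A j z) \<le> exp (c + p * ln L)"
proof -
  define c0 where "c0 = (real k * 2 ^ k * (fact k * 9 * (384 * real k * (4 ^ k)\<^sup>2) ^ k) :: real) ^ k"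
  define c where "c = max 0 (ln c0)"
  define p where "p = real (2 * k * k)"
  have c0: "c0 > 0" using assms by (simp add: c0_def)
  have eq: "(real k * 2 ^ k * (fact k * 9 * (384 * real k * (4 ^ k * L)\<^sup>2) ^ k)) ^ k = c0 * L ^ (2 * k * k)" for L :: real
    by (simp add: c0_def power_mult_distrib mult_ac flip: power_mult)
  have le: "(real k * 2 ^ k * (fact k * 9 * (384 * real k * (4 ^ k * L)\<^sup>2) ^ k)) ^ k \<le> exp (c + p * ln L)"
    if "L \<ge> 1" for L :: real
  proof -
    have "exp (ln c0) \<le> exp c" by (simp add: c_def)
    then have "c0 \<le> exp c" using c0 by simp
    moreover have "L ^ (2 * k * k) = exp (p * ln L)"
      using that by (simp only: p_def exp_of_nat_mult) simp
    ultimately show ?thesis unfolding eq exp_add by simp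
  qed
  show ?thesis
    by (rule that[of c p], simp add: c_def, simp add: p_def)
      (rule order_trans[OF coefficient_bound_explicit[OF assms] le])
qed

section \<open>Comparison of orders\<close>

lemma mono_class_L:
  assumes "\<alpha> \<in> class_L"
  shows "mono \<alpha>"
proof
  fix x y :: real assume xy: "x \<le> y"
  obtain x0 where x0: "\<And>x. x \<le> x0 \<Longrightarrow> \<alpha> x = \<alpha> x0" "mono_on {x0..} \<alpha>"
    using assms unfolding class_L_def by blast
  have "\<alpha> x = \<alpha> (max x x0)" "\<alpha> y = \<alpha> (max y x0)"
    using x0(1)[of x] x0(1)[of y] by (auto simp: max_def)
  moreover have "\<alpha> (max x x0) \<le> \<alpha> (max y x0)"
    using x0(2) xy by (auto intro!: mono_onD[of "{x0..}" \<alpha>])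
  ultimately show "\<alpha> x \<le> \<alpha> y" by simp
qed

lemma class_L_nonneg: "\<alpha> \<in> class_L \<Longrightarrow> 0 \<le> \<alpha> x"
  by (simp add: class_L_def)

lemma class_L_at_top: "\<alpha> \<in> class_L \<Longrightarrow> filterlim \<alpha> at_top at_top"
  by (simp add: class_L_def)

lemma class_L3_multiple:
  assumes "\<gamma> \<in> class_L3" and "K > 0"
  shows "\<forall>\<^sub>F r in at_top. \<gamma> (real K * r) \<le> real K * \<gamma> r"
proof -
  obtain R0 where R0: "\<And>a b. a \<ge> R0 \<Longrightarrow> b \<ge> R0 \<Longrightarrow> \<gamma> (a + b) \<le> \<gamma> a + \<gamma> b"
    using assms(1) unfolding class_L3_def by blast
  have "\<gamma> (real (Suc m) * r) \<le> real (Suc m) * \<gamma> r" if r: "r \<ge> max 0 R0" for m r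
  proof (induction m)
    case (Suc m)
    have "1 * r \<le> real (Suc m) * r" using r by (intro mult_right_mono) auto
    then have "\<gamma> (real (Suc m) * r + r) \<le> \<gamma> (real (Suc m) * r) + \<gamma> r"
      using r by (intro R0) auto
    then show ?case using Suc.IH by (simp add: algebra_simps)
  qed simp
  then show ?thesis using assms(2)
    by (intro eventually_at_top_linorderI[of "max 0 R0"]) (metis Suc_pred)
qed

lemma filterlim_denominator:
  assumes "\<beta> \<in> class_L" "\<gamma> \<in> class_L"
  shows "filterlim (\<lambda>r. \<beta> (ln (\<gamma> r))) at_top at_top"
  by (intro filterlim_compose[OF class_L_at_top[OF assms(1)]] filterlim_compose[OF ln_at_top]
      class_L_at_top[OF assms(2)])

lemma denominator_dilation:
  assumes \<beta>: "\<beta> \<in> class_L2" and \<gamma>: "\<gamma> \<in> class_L3" and "K > 0" and "e > 0"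
  shows "\<forall>\<^sub>F r in at_top. \<beta> (ln (\<gamma> (real K * r))) \<le> (1 + e) * \<beta> (ln (\<gamma> r))"
proof -
  have L: "\<beta> \<in> class_L" "\<gamma> \<in> class_L" using \<beta> \<gamma> by (auto simp: class_L2_def class_L3_def)
  have lim: "filterlim (\<lambda>r. ln (\<gamma> r)) at_top at_top"
    by (intro filterlim_compose[OF ln_at_top] class_L_at_top L)
  have "(\<lambda>_. ln (real K)) \<in> O[at_top](\<lambda>_::real. 1::real)" by simp
  moreover have "\<forall>h\<in>O[at_top](\<lambda>_. 1). asymp_equiv (\<lambda>x. \<beta> (x + h x)) at_top \<beta>"
    using \<beta> by (simp add: class_L2_def)
  ultimately have "asymp_equiv (\<lambda>x. \<beta> (x + ln (real K))) at_top \<beta>" by (rule bspec[rotated])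
  \<comment> \<open>Asymptotic equivalence counts 0/0 as 1; positivity turns it into convergence of
    the plain quotient.\<close>
  moreover have pos: "\<forall>\<^sub>F x in at_top. \<beta> x > 0"
    using class_L_at_top[OF L(1)] unfolding filterlim_at_top_dense by blast
  ultimately have "((\<lambda>x. \<beta> (x + ln (real K)) / \<beta> x) \<longlongrightarrow> 1) at_top"
    by (intro asymp_equivD_strong) (auto elim: eventually_mono)
  then have "\<forall>\<^sub>F x in at_top. \<beta> (x + ln (real K)) / \<beta> x < 1 + e"
    using assms(4) by (intro order_tendstoD) auto
  with pos have "\<forall>\<^sub>F x in at_top. \<beta> (x + ln (real K)) \<le> (1 + e) * \<beta> x"
    by eventually_elim (simp add: field_simps)
  then have "\<forall>\<^sub>F r in at_top. \<beta> (ln (\<gamma> r) + ln (real K)) \<le> (1 + e) * \<beta> (ln (\<gamma> r))"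
    using lim by (rule eventually_compose_filterlim)
  moreover have "\<forall>\<^sub>F r in at_top. \<gamma> r > 0"
    using class_L_at_top[OF L(2)] unfolding filterlim_at_top_dense by blast
  moreover have "filterlim (\<lambda>r. real K * r) at_top at_top"
    using assms(3) by (intro filterlim_tendsto_pos_mult_at_top[OF tendsto_const]) (auto simp: filterlim_ident)
  then have "\<forall>\<^sub>F r in at_top. \<gamma> (real K * r) > 0"
    using \<open>\<forall>\<^sub>F r in at_top. \<gamma> r > 0\<close> by (rule eventually_compose_filterlim[rotated])
  ultimately show ?thesis using class_L3_multiple[OF \<gamma> assms(3)]
  proof eventually_elim
    case (elim r)
    have "ln (\<gamma> (real K * r)) \<le> ln (real K * \<gamma> r)"
      using elim assms(3) by (subst ln_le_cancel_iff) auto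
    also have "\<dots> = ln (\<gamma> r) + ln (real K)" using elim assms(3) by (simp add: ln_mult)
    finally have "\<beta> (ln (\<gamma> (real K * r))) \<le> \<beta> (ln (\<gamma> r) + ln (real K))"
      using mono_class_L[OF L(1)] by (rule monoD[rotated])
    with elim show ?case by simp
  qed
qed

text \<open>The common form of both inequalities: \<open>Y\<close> is \<open>ln\<close> of the
  characteristic of a solution and \<open>P j\<close> the characteristic of a coefficient, or vice
  versa. The index in the last hypothesis may vary with \<open>r\<close>; finiteness of
  \<open>J\<close> makes the bounds on all \<open>P j\<close> hold simultaneously.\<close>

lemma Limsup_growth_le:
  fixes Y D :: "real \<Rightarrow> real" and P :: "'a \<Rightarrow> real \<Rightarrow> real"
  assumes \<alpha>: "\<alpha> \<in> class_L1" and J: "finite J" "J \<noteq> {}"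
    and D: "filterlim D at_top at_top" and small: "(\<lambda>r. \<alpha> (ln (ln r))) \<in> o[at_top](D)"
    and dil: "\<And>e. e > 0 \<Longrightarrow> \<forall>\<^sub>F r in at_top. D (K * r) \<le> (1 + e) * D r" and K: "K > 0"
    and Y: "\<forall>\<^sub>F r in at_top. \<exists>j\<in>J. ln (Y r) \<le> C + max (ln (ln r)) (ln (P j (K * r)))"
  shows "Limsup at_top (\<lambda>r. ereal (\<alpha> (ln (Y r)) / D r))
     \<le> (SUP j\<in>J. Limsup at_top (\<lambda>r. ereal (\<alpha> (ln (P j r)) / D r)))" (is "?l \<le> ?S")
proof (rule ereal_le_real)
  \<comment> \<open>Testing against real upper bounds avoids arithmetic with infinite
    orders.\<close>
  fix z assume z: "?S \<le> ereal z"
  have L: "\<alpha> \<in> class_L" using \<alpha> by (simp add: class_L1_def)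
  note mono = monoD[OF mono_class_L[OF L]]
  obtain c R0 where c: "c > 0" and R0: "\<And>a b. a \<ge> R0 \<Longrightarrow> b \<ge> R0 \<Longrightarrow> \<alpha> (a + b) \<le> \<alpha> a + \<alpha> b + c"
    using \<alpha> unfolding class_L1_def by blast
  have Dpos: "\<forall>\<^sub>F r in at_top. D r > 0" using D unfolding filterlim_at_top_dense by blast
  have j_le: "Limsup at_top (\<lambda>r. ereal (\<alpha> (ln (P j r)) / D r)) \<le> ereal z" if "j \<in> J" for j
    using SUP_upper[OF that, of "\<lambda>j. Limsup at_top (\<lambda>r. ereal (\<alpha> (ln (P j r)) / D r))"] z
    by (rule order_trans)
  \<comment> \<open>This permits multiplying \<open>D (K * r) \<le> (1 + e) * D r\<close> by
    \<open>z + e\<close>.\<close>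
  have z0: "z \<ge> 0"
  proof -
    obtain j where "j \<in> J" using J by blast
    have "0 \<le> Limsup at_top (\<lambda>r. ereal (\<alpha> (ln (P j r)) / D r))"
      by (rule le_Limsup) (use Dpos in \<open>auto elim!: eventually_mono simp: class_L_nonneg[OF L]\<close>)
    with j_le[OF \<open>j \<in> J\<close>] show ?thesis by (metis ereal_less_eq(5) order_trans)
  qed
  have lim_K: "filterlim (\<lambda>r. K * r) at_top at_top"
    using K by (intro filterlim_tendsto_pos_mult_at_top[OF tendsto_const]) (auto simp: filterlim_ident)
  have main: "\<forall>\<^sub>F r in at_top. \<alpha> (ln (Y r)) / D r \<le> (z + e) * (1 + e) + 2 * e" if e: "e > 0" for e
  proof -
    have "\<forall>\<^sub>F r in at_top. \<alpha> (ln (P j r)) / D r < z + e" if "j \<in> J" for j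
    proof -
      note j_le[OF that]
      also have "ereal z < ereal (z + e)" using e by simp
      finally have "Limsup at_top (\<lambda>r. ereal (\<alpha> (ln (P j r)) / D r)) < ereal (z + e)" .
      from Limsup_lessD[OF this] show ?thesis by simp
    qed
    then have "\<forall>\<^sub>F r in at_top. \<forall>j\<in>J. \<alpha> (ln (P j r)) / D r < z + e"
      using J by (intro eventually_ball_finite) auto
    with Dpos have "\<forall>\<^sub>F r in at_top. \<forall>j\<in>J. \<alpha> (ln (P j r)) \<le> (z + e) * D r"
      by eventually_elim (auto simp: field_simps less_imp_le)
    then have P: "\<forall>\<^sub>F r in at_top. \<forall>j\<in>J. \<alpha> (ln (P j (K * r))) \<le> (z + e) * D (K * r)"
      using lim_K by (rule eventually_compose_filterlim)
    have s: "\<forall>\<^sub>F r in at_top. \<alpha> (ln (ln r)) \<le> e * D r"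
      using landau_o.smallD[OF small e] Dpos by eventually_elim (auto simp: class_L_nonneg[OF L])
    have "filterlim (\<lambda>r. ln (ln (r::real))) at_top at_top"
      by (intro filterlim_compose[OF ln_at_top] ln_at_top)
    then have R: "\<forall>\<^sub>F r in at_top. ln (ln (r::real)) \<ge> R0" unfolding filterlim_at_top by blast
    have "\<forall>\<^sub>F r in at_top. (\<alpha> (max C R0) + c) / e \<le> D r" using D unfolding filterlim_at_top by blast
    then have const: "\<forall>\<^sub>F r in at_top. \<alpha> (max C R0) + c \<le> e * D r"
      by eventually_elim (use e in \<open>simp add: field_simps\<close>)
    from Dpos Y P s R const dil[OF e] show ?thesis
    proof eventually_elim
      case (elim r)
      obtain j where j: "j \<in> J" "ln (Y r) \<le> C + max (ln (ln r)) (ln (P j (K * r)))" using elim(2) by blast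
      define x where "x = max (ln (ln r)) (ln (P j (K * r)))"
      \<comment> \<open>Raising \<open>C\<close> to at least \<open>R0\<close> makes the defining
        inequality of \<open>class_L1\<close> applicable to both summands.\<close>
      have "\<alpha> (ln (Y r)) \<le> \<alpha> (max C R0 + x)" using j(2) by (intro mono) (auto simp: x_def)
      also have "\<dots> \<le> \<alpha> (max C R0) + \<alpha> x + c" using elim(5) by (intro R0) (auto simp: x_def)
      also have "\<alpha> x \<le> \<alpha> (ln (ln r)) + \<alpha> (ln (P j (K * r)))"
        unfolding x_def by (auto simp: max_def class_L_nonneg[OF L])
      also have "\<alpha> (ln (P j (K * r))) \<le> (z + e) * D (K * r)" using elim(3) j by blast
      also have "\<dots> \<le> (z + e) * ((1 + e) * D r)" using elim(7) z0 e by (intro mult_left_mono) auto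
      also note elim(4)
      finally have "\<alpha> (ln (Y r)) \<le> ((z + e) * (1 + e) + 2 * e) * D r"
        using elim(6) by (simp add: algebra_simps)
      then show ?case using elim(1) by (simp add: field_simps)
    qed
  qed
  show "?l \<le> ereal z"
  proof (rule ereal_le_epsilon2)
    fix d :: real assume d: "d > 0"
    define e where "e = min 1 (d / (z + 4))"
    have "e \<le> d / (z + 4)" by (simp add: e_def)
    then have "e * (z + 4) \<le> d" using z0 by (simp add: pos_le_divide_eq)
    moreover have "e > 0" "e \<le> 1" using d z0 by (auto simp: e_def)
    ultimately have e: "e > 0" "e \<le> 1" "e * (z + 4) \<le> d" by auto
    have "(z + e) * (1 + e) + 2 * e = z + e * (z + 3 + e)" by (simp add: algebra_simps)
    also have "\<dots> \<le> z + e * (z + 4)" using e by (intro add_left_mono mult_left_mono) auto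
    also have "\<dots> \<le> z + d" using e by simp
    finally have le: "(z + e) * (1 + e) + 2 * e \<le> z + d" .
    have "?l \<le> ereal (z + d)"
      by (rule Limsup_bounded) (use main[OF e(1)] le in \<open>auto elim!: eventually_mono\<close>)
    then show "?l \<le> ereal z + ereal d" by simp
  qed
qed

section \<open>The two growth inequalities\<close>

lemma eventually_ln_ge: "\<forall>\<^sub>F r::real in at_top. c \<le> ln r"
  using ln_at_top unfolding filterlim_at_top by blast

text \<open>For nonpositive \<open>v\<close> the maximum is \<open>u\<close>, so the value of
  \<open>ln v\<close> does no harm.\<close>

lemma ln_le_of_max_bound:
  fixes t c u v :: real
  assumes "0 < t" "t \<le> c * max u v" "1 \<le> u" "0 < c"
  shows "ln t \<le> ln c + max (ln u) (ln v)"
proof -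
  have "ln t \<le> ln (c * max u v)" using assms by (subst ln_le_cancel_iff) auto
  also have "\<dots> = ln c + ln (max u v)" using assms by (simp add: ln_mult)
  also have "ln (max u v) \<le> max (ln u) (ln v)" by (auto simp: max_def)
  finally show ?thesis by simp
qed

lemma obtain_max_index:
  fixes g :: "nat \<Rightarrow> real"
  assumes "k > 0"
  obtains j where "j < k" "\<And>i. i < k \<Longrightarrow> g i \<le> g j"
proof -
  have fin: "finite (g ` {..<k})" "g ` {..<k} \<noteq> {}" using assms by auto
  from Max_in[OF this] obtain j where j: "j < k" "Max (g ` {..<k}) = g j" by auto
  have "g i \<le> g j" if "i < k" for i
    using Max_ge[OF fin(1), of "g i"] that j(2) by simp
  then show ?thesis using that j(1) by blast
qed

lemma growth_solution_le:
  assumes A: "\<And>j. j < k \<Longrightarrow> A j holomorphic_on UNIV" and k: "k > 0"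
    and f: "f holomorphic_on UNIV" and L: "\<And>z. lin_diff_op k A f z = 0"
  shows "\<exists>C. \<forall>\<^sub>F r in at_top. \<exists>j<k. ln (ln (nevanlinna_T r f)) \<le>
     C + max (ln (ln r)) (ln (nevanlinna_T (2 * r) (A j)))"
\<comment> \<open>For nonconstant \<open>f\<close> the characteristic tends to infinity and its
  iterated logarithms are genuine. For constant \<open>f\<close> the left-hand side is a fixed
  number and is itself taken as \<open>C\<close>.\<close>
proof (cases "f constant_on UNIV")
  case True
  then obtain a where "f = (\<lambda>_. a)" unfolding constant_on_def by auto
  then have T: "nevanlinna_T r f = log_plus (norm a)" for r by (simp add: nevanlinna_T_const)
  have "\<forall>\<^sub>F r in at_top. \<exists>j<k. ln (ln (nevanlinna_T r f)) \<le>
     ln (ln (log_plus (norm a))) + max (ln (ln r)) (ln (nevanlinna_T (2 * r) (A j)))"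
    using eventually_ln_ge[of 1]
  proof eventually_elim
    case (elim r)
    then have "0 \<le> ln (ln r)" by simp
    then show ?case using k by (auto simp: T intro!: exI[of _ 0])
  qed
  then show ?thesis by blast
next
  case False
  define c where "c = max 0 (ln (sqrt (\<Sum>j<k. (norm ((deriv ^^ j) f 0))\<^sup>2)))"
  define c1 where "c1 = c + k * (1 + k)"
  have c: "c \<ge> 0" "sqrt (\<Sum>j<k. (norm ((deriv ^^ j) f 0))\<^sup>2) \<le> exp c"
  proof -
    show "c \<ge> 0" by (simp add: c_def)
    show "sqrt (\<Sum>j<k. (norm ((deriv ^^ j) f 0))\<^sup>2) \<le> exp c"
    proof (cases "sqrt (\<Sum>j<k. (norm ((deriv ^^ j) f 0))\<^sup>2) > 0")
      case True
      have "exp (ln (sqrt (\<Sum>j<k. (norm ((deriv ^^ j) f 0))\<^sup>2))) \<le> exp c" by (simp add: c_def)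
      with True show ?thesis by (simp del: real_sqrt_gt_0_iff)
    next
      case False
      then show ?thesis using exp_gt_zero[of c] by linarith
    qed
  qed
  have c1: "c1 > 0" using c(1) k by (simp add: c1_def add_nonneg_pos)
  have "\<forall>\<^sub>F r in at_top. nevanlinna_T r f \<ge> exp 1"
    using nevanlinna_T_at_top[OF f False] unfolding filterlim_at_top by blast
  then have "\<forall>\<^sub>F r in at_top. \<exists>j<k. ln (ln (nevanlinna_T r f)) \<le>
     ln (\<bar>ln c1\<bar> + 4) + max (ln (ln r)) (ln (nevanlinna_T (2 * r) (A j)))"
    using eventually_ln_ge[of 1] eventually_ge_at_top[of 1]
  proof eventually_elim
    case (elim r)
    obtain j where j: "j < k"
      and jmax: "\<And>i. i < k \<Longrightarrow> nevanlinna_T (2 * r) (A i) \<le> nevanlinna_T (2 * r) (A j)"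
      using obtain_max_index[OF k, of "\<lambda>j. nevanlinna_T (2 * r) (A j)"] by blast
    define t where "t = nevanlinna_T (2 * r) (A j)"
    have t0: "t \<ge> 0" unfolding t_def by (rule nevanlinna_T_nonneg[OF A[OF j]])
    define mu where "mu = (1 + k) * exp (3 * t)"
    have mu: "1 + (\<Sum>i<k. norm (A i z)) \<le> mu" if "norm z \<le> r" for z
    proof -
      have "(\<Sum>i<k. norm (A i z)) \<le> (\<Sum>i<k. exp (3 * t))"
      proof (rule sum_mono)
        fix i assume "i \<in> {..<k}"
        then have i: "i < k" by simp
        have "norm (A i z) \<le> exp (3 * nevanlinna_T (2 * r) (A i))"
          by (rule norm_le_exp_nevanlinna_T[OF A[OF i]]) (use elim that in auto)
        also have "\<dots> \<le> exp (3 * t)" using jmax[OF i] by (simp add: t_def)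
        finally show "norm (A i z) \<le> exp (3 * t)" .
      qed
      moreover have "1 \<le> exp (3 * t)" using t0 by simp
      moreover have "mu = exp (3 * t) + (\<Sum>i<k. exp (3 * t))" by (simp add: mu_def distrib_right)
      ultimately show ?thesis by linarith
    qed
    have mu0: "mu \<ge> 0" by (simp add: mu_def)
    have "nevanlinna_T r f \<le> c + k * mu * r"
    proof (rule nevanlinna_T_le[OF f])
      show "norm (f z) \<le> exp (c + k * mu * r)" if "norm z \<le> r" for z
        using order_trans[OF norm_solution_le[OF f L mu k that] mult_right_mono[OF c(2)]]
        by (simp add: exp_add)
    qed (use c mu0 elim in auto)
    also have "\<dots> \<le> c1 * (r * exp (3 * t))"
    proof -
      have "1 \<le> r * exp (3 * t)" using mult_mono[of 1 r 1 "exp (3 * t)"] elim t0 by simp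
      from mult_left_mono[OF this c(1)] show ?thesis by (simp add: c1_def mu_def algebra_simps)
    qed
    finally have le: "nevanlinna_T r f \<le> c1 * (r * exp (3 * t))" .
    have Tpos: "nevanlinna_T r f > 0" using elim(1) exp_gt_zero[of 1] by linarith
    have "ln (exp 1) \<le> ln (nevanlinna_T r f)" using elim(1) Tpos by (subst ln_le_cancel_iff) auto
    then have ln1: "ln (nevanlinna_T r f) \<ge> 1" by simp
    have "ln (nevanlinna_T r f) \<le> ln (c1 * (r * exp (3 * t)))"
      using le Tpos by (subst ln_le_cancel_iff) auto
    also have "\<dots> = ln c1 + ln r + 3 * t" using c1 elim by (simp add: ln_mult)
    \<comment> \<open>The 4 is 1 for \<open>ln r\<close> plus 3 for \<open>3 * t\<close>; the
      constant is absorbed because \<open>ln r \<ge> 1\<close>.\<close>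
    also have "\<dots> \<le> (\<bar>ln c1\<bar> + 4) * max (ln r) t"
    proof -
      have "\<bar>ln c1\<bar> * 1 \<le> \<bar>ln c1\<bar> * max (ln r) t" using elim by (intro mult_left_mono) auto
      moreover have "(\<bar>ln c1\<bar> + 4) * max (ln r) t = \<bar>ln c1\<bar> * max (ln r) t + 4 * max (ln r) t"
        by (rule distrib_right)
      ultimately show ?thesis by linarith
    qed
    finally have "ln (ln (nevanlinna_T r f)) \<le> ln (\<bar>ln c1\<bar> + 4) + max (ln (ln r)) (ln t)"
      using ln1 elim by (intro ln_le_of_max_bound) auto
    then show ?case using j unfolding t_def by blast
  qed
  then show ?thesis by blast
qed

lemma growth_coefficient_le:
  assumes A: "\<And>j. j < k \<Longrightarrow> A j holomorphic_on UNIV" and k: "k > 0"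
    and f: "\<And>i. i < k \<Longrightarrow> f i holomorphic_on UNIV" and Lf: "\<And>i z. i < k \<Longrightarrow> lin_diff_op k A (f i) z = 0"
    and init: "\<And>i m. i < k \<Longrightarrow> m < k \<Longrightarrow> (deriv ^^ m) (f i) 0 = (if m = i then 1 else 0)"
    and j: "j < k"
  shows "\<exists>C. \<forall>\<^sub>F r in at_top. \<exists>i<k. ln (nevanlinna_T r (A j)) \<le>
     C + max (ln (ln r)) (ln (ln (nevanlinna_T (20 * r) (f i))))"
proof (cases "A j constant_on UNIV")
  case True
  then obtain a where "A j = (\<lambda>_. a)" unfolding constant_on_def by auto
  then have T: "nevanlinna_T r (A j) = log_plus (norm a)" for r by (simp add: nevanlinna_T_const)
  have "\<forall>\<^sub>F r in at_top. \<exists>i<k. ln (nevanlinna_T r (A j)) \<le>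
     ln (log_plus (norm a)) + max (ln (ln r)) (ln (ln (nevanlinna_T (20 * r) (f i))))"
    using eventually_ln_ge[of 1]
  proof eventually_elim
    case (elim r)
    then have "0 \<le> ln (ln r)" by simp
    then show ?case using k by (auto simp: T intro!: exI[of _ 0])
  qed
  then show ?thesis by blast
next
  case False
  obtain c p :: real where cp: "c \<ge> 0" "p \<ge> 0" and bound: "\<And>A f (r::real) L j z.
    (\<And>j. j < k \<Longrightarrow> A j holomorphic_on UNIV) \<Longrightarrow>
    (\<And>i. f i holomorphic_on UNIV) \<Longrightarrow> (\<And>i z. i < k \<Longrightarrow> lin_diff_op k A (f i) z = 0) \<Longrightarrow>
    (\<And>i m. i < k \<Longrightarrow> m < k \<Longrightarrow> (deriv ^^ m) (f i) 0 = (if m = i then 1 else 0)) \<Longrightarrow>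
    r \<ge> k \<Longrightarrow> L \<ge> 1 \<Longrightarrow> (\<And>i z. norm z \<le> 10 * r \<Longrightarrow> norm (f i z) \<le> exp L) \<Longrightarrow>
    j < k \<Longrightarrow> norm z \<le> r \<Longrightarrow> norm (A j z) \<le> exp (c + p * ln L)"
    using ln_coefficient_bound[OF k] by blast
  \<comment> \<open>Padding by zero functions, since \<open>bound\<close> speaks of a family indexed
    by all natural numbers.\<close>
  define g where "g i = (if i < k then f i else (\<lambda>_. 0))" for i
  have "\<forall>\<^sub>F r in at_top. nevanlinna_T r (A j) \<ge> 1"
    using nevanlinna_T_at_top[OF A[OF j] False] unfolding filterlim_at_top by blast
  then have "\<forall>\<^sub>F r in at_top. \<exists>i<k. ln (nevanlinna_T r (A j)) \<le>
     ln (c + 3 * p + 1) + max (ln (ln r)) (ln (ln (nevanlinna_T (20 * r) (f i))))"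
    using eventually_ln_ge[of 1] eventually_ge_at_top[of "max 1 (real k)"]
  proof eventually_elim
    case (elim r)
    obtain i where i: "i < k"
      and imax: "\<And>l. l < k \<Longrightarrow> nevanlinna_T (20 * r) (f l) \<le> nevanlinna_T (20 * r) (f i)"
      using obtain_max_index[OF k, of "\<lambda>i. nevanlinna_T (20 * r) (f i)"] by blast
    define t where "t = nevanlinna_T (20 * r) (f i)"
    have t0: "t \<ge> 0" unfolding t_def by (rule nevanlinna_T_nonneg[OF f[OF i]])
    \<comment> \<open>Including \<open>r\<close> gives \<open>ln u \<ge> 1\<close> however slowly
      the solutions grow. The exponent \<open>4 * u\<close> used below dominates both
      \<open>3 * t\<close> and 1.\<close>
    define u where "u = max r t"
    have u: "u \<ge> 1" "ln u \<ge> 1"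
    proof -
      show "u \<ge> 1" using elim by (auto simp: u_def)
      have "ln r \<le> ln u" using elim by (subst ln_le_cancel_iff) (auto simp: u_def)
      then show "ln u \<ge> 1" using elim by simp
    qed
    have le: "norm (A j z) \<le> exp (c + p * ln (4 * u))" if "norm z \<le> r" for z
    proof (rule bound[where f = g and A = A and r = r, OF A])
      show "g i holomorphic_on UNIV" for i using f by (simp add: g_def)
      show "lin_diff_op k A (g i) z = 0" if "i < k" for i z using Lf that by (simp add: g_def)
      show "(deriv ^^ m) (g i) 0 = (if m = i then 1 else 0)" if "i < k" "m < k" for i m
        using init that by (simp add: g_def)
      show "norm (g l w) \<le> exp (4 * u)" if "norm w \<le> 10 * r" for l w
      proof (cases "l < k")
        case True
        have "norm (f l w) \<le> exp (3 * nevanlinna_T (2 * (10 * r)) (f l))"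
          by (rule norm_le_exp_nevanlinna_T[OF f[OF True]]) (use elim that in auto)
        also have "\<dots> \<le> exp (4 * u)"
          using imax[OF True] u t0 by (simp add: t_def u_def)
        finally show ?thesis using True by (simp add: g_def)
      qed (simp add: g_def)
    qed (use elim u j that in auto)
    have lnu: "ln (4 * u) \<le> 3 * ln u"
    proof -
      have "ln (4 * u) = ln (2 * 2) + ln u" using u by (simp add: ln_mult)
      also have "ln (2 * 2 :: real) = 2 * ln 2" by (simp only: ln_mult) simp
      also have "\<dots> \<le> 2" using ln_2_less_1 by simp
      finally show ?thesis using u by simp
    qed
    have "nevanlinna_T r (A j) \<le> c + p * ln (4 * u)"
      using A[OF j] le cp u elim by (intro nevanlinna_T_le) (auto simp: ln_ge_zero intro!: add_nonneg_nonneg mult_nonneg_nonneg)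
    also have "\<dots> \<le> c * ln u + p * (3 * ln u)"
      using cp u mult_left_mono[OF u(2) cp(1)] lnu by (intro add_mono mult_left_mono) auto
    also have "\<dots> \<le> (c + 3 * p + 1) * ln u" using u by (simp add: algebra_simps)
    also have "ln u = max (ln r) (ln t) \<or> ln u \<le> ln r" by (auto simp: u_def max_def)
    then have "ln u \<le> max (ln r) (ln t)" by auto
    then have "(c + 3 * p + 1) * ln u \<le> (c + 3 * p + 1) * max (ln r) (ln t)"
      using cp by (intro mult_left_mono) auto
    finally have "ln (nevanlinna_T r (A j)) \<le> ln (c + 3 * p + 1) + max (ln (ln r)) (ln (ln t))"
      using elim cp by (intro ln_le_of_max_bound) auto
    then show ?case using i unfolding t_def by blast
  qed
  then show ?thesis by blast
qed

theorem theorem1: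
  fixes \<alpha> \<beta> \<gamma> :: "real \<Rightarrow> real"
    and k :: nat
    and A :: "nat \<Rightarrow> complex \<Rightarrow> complex"
  assumes "\<alpha> \<in> class_L1" and "\<beta> \<in> class_L2" and "\<gamma> \<in> class_L3"
    and "growth_conditions \<alpha> \<beta> \<gamma>"
    and "k \<ge> 2"
    and "\<And>j. j < k \<Longrightarrow> A j holomorphic_on UNIV"
  shows "(SUP f\<in>nontrivial_solutions k A. growth_order (\<lambda>x. \<alpha> (ln x)) \<beta> \<gamma> f)
       = (SUP j\<in>{..<k}. growth_order \<alpha> \<beta> \<gamma> (A j))"
proof -
  note A = assms(6)
  have k: "k > 0" using assms(5) by simp
  define D where "D r = \<beta> (ln (\<gamma> r))" for r
  have D: "filterlim D at_top at_top"
    unfolding D_def[abs_def] using assms(2,3) by (intro filterlim_denominator) (auto simp: class_L2_def class_L3_def)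
  have small: "(\<lambda>r. \<alpha> (ln (ln r))) \<in> o[at_top](D)"
  proof -
    have "(\<lambda>x. \<alpha> ((ln ^^ 2) x)) \<in> o[at_top](D)"
      using assms(4) unfolding growth_conditions_def D_def[abs_def] by blast
    then show ?thesis by (simp add: numeral_2_eq_2)
  qed
  have dil: "\<forall>\<^sub>F r in at_top. D (real K * r) \<le> (1 + e) * D r" if "K > 0" "e > 0" for K e
    unfolding D_def by (rule denominator_dilation[OF assms(2,3) that])
  have order: "growth_order \<alpha> \<beta> \<gamma> g = Limsup at_top (\<lambda>r. ereal (\<alpha> (ln (nevanlinna_T r g)) / D r))"
    "growth_order (\<lambda>x. \<alpha> (ln x)) \<beta> \<gamma> g = Limsup at_top (\<lambda>r. ereal (\<alpha> (ln (ln (nevanlinna_T r g))) / D r))" for g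
    by (simp_all add: growth_order_def D_def)
  have J: "finite {..<k}" "{..<k} \<noteq> {}" using k by auto
  show ?thesis
  proof (rule antisym)
    show "(SUP f\<in>nontrivial_solutions k A. growth_order (\<lambda>x. \<alpha> (ln x)) \<beta> \<gamma> f)
       \<le> (SUP j\<in>{..<k}. growth_order \<alpha> \<beta> \<gamma> (A j))"
    proof (rule SUP_least)
      fix f assume "f \<in> nontrivial_solutions k A"
      then have f: "f holomorphic_on UNIV" "\<And>z. lin_diff_op k A f z = 0"
        by (auto simp: nontrivial_solutions_def)
      obtain C where "\<forall>\<^sub>F r in at_top. \<exists>j<k. ln (ln (nevanlinna_T r f)) \<le>
          C + max (ln (ln r)) (ln (nevanlinna_T (2 * r) (A j)))"
        using growth_solution_le[OF A k f] by blast
      then show "growth_order (\<lambda>x. \<alpha> (ln x)) \<beta> \<gamma> f \<le> (SUP j\<in>{..<k}. growth_order \<alpha> \<beta> \<gamma> (A j))"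
        unfolding order using dil[of 2]
        by (intro Limsup_growth_le[OF assms(1) J D small, where K = 2]) (auto simp: Bex_def)
    qed
    \<comment> \<open>The \<open>k\<close> solutions with unit initial values already account for
      every coefficient; the supremum over all solutions enters only through these.\<close>
    have "\<exists>f. f holomorphic_on UNIV \<and> (\<forall>z. lin_diff_op k A f z = 0) \<and>
       (\<forall>m<k. (deriv ^^ m) f 0 = (if m = i then 1 else 0))" for i
      using linear_ode_solution[where k = k and A = A and c = "\<lambda>m. if m = i then 1 else 0", OF A k] by metis
    then obtain f where f: "\<And>i. f i holomorphic_on UNIV" "\<And>i z. lin_diff_op k A (f i) z = 0"
       "\<And>i m. m < k \<Longrightarrow> (deriv ^^ m) (f i) 0 = (if m = i then 1 else 0)"
      by metis
    have sol: "f i \<in> nontrivial_solutions k A" if "i < k" for i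
    proof -
      have "f i \<noteq> (\<lambda>_. 0)" using f(3)[OF that, of i] by auto
      then show ?thesis using f by (auto simp: nontrivial_solutions_def)
    qed
    show "(SUP j\<in>{..<k}. growth_order \<alpha> \<beta> \<gamma> (A j))
       \<le> (SUP f\<in>nontrivial_solutions k A. growth_order (\<lambda>x. \<alpha> (ln x)) \<beta> \<gamma> f)"
    proof (rule SUP_least)
      fix j assume "j \<in> {..<k}"
      then have j: "j < k" by simp
      obtain C where "\<forall>\<^sub>F r in at_top. \<exists>i<k. ln (nevanlinna_T r (A j)) \<le>
          C + max (ln (ln r)) (ln (ln (nevanlinna_T (20 * r) (f i))))"
        using growth_coefficient_le[OF A k f(1) f(2) f(3) j] by blast
      then have "growth_order \<alpha> \<beta> \<gamma> (A j) \<le> (SUP i\<in>{..<k}. growth_order (\<lambda>x. \<alpha> (ln x)) \<beta> \<gamma> (f i))"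
        unfolding order using dil[of 20]
        by (intro Limsup_growth_le[OF assms(1) J D small, where K = 20]) (auto simp: Bex_def)
      also have "\<dots> \<le> (SUP f\<in>nontrivial_solutions k A. growth_order (\<lambda>x. \<alpha> (ln x)) \<beta> \<gamma> f)"
        by (rule SUP_least) (auto intro!: SUP_upper sol)
      finally show "growth_order \<alpha> \<beta> \<gamma> (A j)
         \<le> (SUP f\<in>nontrivial_solutions k A. growth_order (\<lambda>x. \<alpha> (ln x)) \<beta> \<gamma> f)" .
    qed
  qed
qed

end
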